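(* Let $(\Omega,\mathcal F,\mathbb P)$, $(\tau_i)_{i\in\mathbb Z}$ and the random potential $J$ be as in the context; in particular $J$ satisfies (A1)--(A4). Assume in addition that the ground state satisfies $\delta(\omega)=1$ for $\mathbb P$-a.e. $\omega\in\Omega$. For $n\in\mathbb N$ let $\ell_n^*(\omega)$ be the critical stretch of the chain with $n+1$ particles and consider the rescaled jump threshold $$\gamma_n^*(\omega):=\frac{\ell_n^*(\omega)-1}{\sqrt{1/n}}.$$ Then $$\lim_{n\to\infty}\gamma_n^*(\omega)=\sqrt{\frac{\beta}{\underline\alpha}}\qquad\text{for }\mathbb P\text{-a.e. }\omega\in\Omega,$$ where $$\underline\alpha:=\Big(\mathbb E\Big[\big(\tfrac12J''(\omega,1)\big)^{-1}\Big]\Big)^{-1}\qquad\text{and}\qquad\beta:=\operatorname*{ess\,inf}_{\omega\in\Omega}\,(-J(\omega,1)).$$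
   Context: Probabilistic setup. $(\Omega,\mathcal F,\mathbb P)$ is a probability space, $\mathbb E$ denotes expectation, and $(\tau_i)_{i\in\mathbb Z}$ is a family of measurable maps $\tau_i:\Omega\to\Omega$ such that: (group property) $\tau_0\omega=\omega$ for all $\omega\in\Omega$ and $\tau_{i_1+i_2}=\tau_{i_1}\tau_{i_2}$ for all $i_1,i_2\in\mathbb Z$; (stationarity) $\mathbb P(\tau_iB)=\mathbb P(B)$ for every $B\in\mathcal F$ and $i\in\mathbb Z$; (ergodicity) for every $B\in\mathcal F$, if $\tau_i(B)=B$ for all $i\in\mathbb Z$, then $\mathbb P(B)=0$ or $\mathbb P(B)=1$. Assumptions on the potential. "Monotonically increasing" is understood in the non-strict sense. $J:\Omega\times\mathbb R\to\mathbb R\cup\{+\infty\}$ is jointly measurable with $J(\omega,z)=+\infty$ if $z\le 0$. Primes denote derivatives in $z$. For $\mathbb P$-a.e. $\omega\in\Omega$ the following hold: (A1) $J(\omega,\cdot)\in C^3(0,\infty)$ (in particular finite there). (A2) There exist functions $\psi^+,\psi^-\in C(0,\infty)$, independent of $\omega$, with $\lim_{z\to0^+}\psi^-(z)=\infty$ and $\lim_{z\to\infty}\psi^+(z)=0$, such that $J(\omega,z)\ge\psi^-(z)$ for all $0<z\le1$ and $|J(\omega,z)|\le\psi^+(z)$ for all $z\ge1$. (A3) $z_{\mathrm{frac}}(\omega):=\sup\{z>0: J''(\omega,s)>0\text{ for all }s\in(0,z)\}>0$, and $J(\omega,\cdot)$ is monotonically increasing on $[z_{\mathrm{frac}}(\omega),\infty)$.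 $J(\omega,\cdot)$ admits a unique minimizer, denoted $\delta(\omega)$ and called the ground state. (A4) There exists a constant $c>0$, independent of $\omega$, such that $c<\delta(\omega)<\frac1c$ and for all $z\in(\delta(\omega)-c,\delta(\omega)+c)$: $c\le J''(\omega,z)\le\frac1c$ and $|J'''(\omega,z)|\le\frac1c$. Discrete chain. For $n\in\mathbb N$, $\mathcal A_n$ is the set of $u\in C([0,1])$ that are affine on $(\frac in,\frac{i+1}n)$ for every $i\in\{0,\dots,n-1\}$ and monotonically increasing. For $\ell\ge0$, $\mathcal A_{n,\ell}:=\{u\in\mathcal A_n: u(0)=0,\ u(1)=\ell\}$. The energy is $$E_n(\omega,u):=\sum_{i=0}^{n-1}\frac1nJ\Big(\tau_i\omega,n\big(u(\tfrac{i+1}n)-u(\tfrac in)\big)\Big).$$ The set of purely elastic deformations is $$\mathcal A_n^{\rm el}(\omega):=\Big\{u\in\mathcal A_n: n\big(u(\tfrac{i+1}n)-u(\tfrac in)\big)\le z_{\mathrm{frac}}(\tau_i\omega)\text{ for all }i=0,\dots,n-1\Big\}.$$ The critical stretch $\ell_n^*(\omega)$ is the largest number such that $$\inf_{\mathcal A_n^{\rm el}(\omega)\cap\mathcal A_{n,\ell}}E_n(\omega,\cdot)=\inf_{\mathcal A_{n,\ell}}E_n(\omega,\cdot)\qquad\text{for all }0\le\ell<\ell_n^*(\omega),$$ with the convention $\inf\emptyset=+\infty$. *)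

theory Defs
  imports "HOL-Probability.Probability"
begin

locale ergodic_shift = prob_space M for M :: "'a measure" +
  fixes \<tau> :: "int \<Rightarrow> 'a \<Rightarrow> 'a"
  assumes shift_measurable: "\<And>i. \<tau> i \<in> measurable M M"
    and shift_0: "\<And>\<omega>. \<omega> \<in> space M \<Longrightarrow> \<tau> 0 \<omega> = \<omega>"
    and shift_add: "\<And>i j \<omega>. \<omega> \<in> space M \<Longrightarrow> \<tau> (i + j) \<omega> = \<tau> i (\<tau> j \<omega>)"
    and stationary: "\<And>i B. B \<in> sets M \<Longrightarrow> measure M (\<tau> i ` B) = measure M B"
    and ergodic: "\<And>B. B \<in> sets M \<Longrightarrow> (\<And>i. \<tau> i ` B = B) \<Longrightarrow>
      measure M B = 0 \<or> measure M B = 1"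

text \<open>
  A potential takes values in \<open>ereal\<close>, and is \<open>\<infinity>\<close> on \<open>z \<le> 0\<close>. On \<open>z > 0\<close>, where it is
  finite, derivatives in \<open>z\<close> are those of its real-valued version.
\<close>

definition Dpot :: "nat \<Rightarrow> (real \<Rightarrow> ereal) \<Rightarrow> real \<Rightarrow> real" where
  "Dpot k V = (deriv ^^ k) (\<lambda>z. real_of_ereal (V z))"

definition C3_pos :: "(real \<Rightarrow> ereal) \<Rightarrow> bool" where
  "C3_pos V \<longleftrightarrow>
    (\<forall>z>0. \<bar>V z\<bar> \<noteq> \<infinity>) \<and>
    (\<forall>k<3. \<forall>z>0. Dpot k V field_differentiable (at z)) \<and>
    continuous_on {0<..} (Dpot 3 V)"

text \<open>
  The supremum is taken in \<open>ereal\<close>: the value \<open>\<infinity>\<close> is not excluded by definition, and the empty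
  supremum is \<open>- \<infinity>\<close>, so that positivity of \<open>z_frac\<close> entails that the set is nonempty.
\<close>

definition z_frac :: "(real \<Rightarrow> ereal) \<Rightarrow> ereal" where
  "z_frac V = Sup (ereal ` {z. z > 0 \<and> (\<forall>s\<in>{0<..<z}. Dpot 2 V s > 0)})"

abbreviation is_minimizer :: "(real \<Rightarrow> ereal) \<Rightarrow> real \<Rightarrow> bool" where
  "is_minimizer V \<equiv> is_arg_min V (\<lambda>_. True)"

definition ground_state :: "(real \<Rightarrow> ereal) \<Rightarrow> real" where
  "ground_state V = arg_min V (\<lambda>_. True)"

locale random_potential =
  fixes M :: "'a measure" and J :: "'a \<Rightarrow> real \<Rightarrow> ereal"
  assumes measurable_J: "(\<lambda>(\<omega>, z). J \<omega> z) \<in> borel_measurable (M \<Otimes>\<^sub>M borel)"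
    and J_not_MInf: "\<And>\<omega> z. \<omega> \<in> space M \<Longrightarrow> J \<omega> z \<noteq> - \<infinity>"
    and J_nonpos: "\<And>\<omega> z. \<omega> \<in> space M \<Longrightarrow> z \<le> 0 \<Longrightarrow> J \<omega> z = \<infinity>"
    and A1: "AE \<omega> in M. C3_pos (J \<omega>)"
    and A2: "\<exists>\<psi>p \<psi>m :: real \<Rightarrow> real.
      continuous_on {0<..} \<psi>p \<and> continuous_on {0<..} \<psi>m \<and>
      filterlim \<psi>m at_top (at_right 0) \<and> (\<psi>p \<longlongrightarrow> 0) at_top \<and>
      (AE \<omega> in M. (\<forall>z. 0 < z \<and> z \<le> 1 \<longrightarrow> J \<omega> z \<ge> ereal (\<psi>m z)) \<and>
                  (\<forall>z\<ge>1. \<bar>J \<omega> z\<bar> \<le> ereal (\<psi>p z)))"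
    and A3: "AE \<omega> in M. z_frac (J \<omega>) > 0 \<and> mono_on {z. z_frac (J \<omega>) \<le> ereal z} (J \<omega>)"
    and unique_minimizer: "AE \<omega> in M. \<exists>!z. is_minimizer (J \<omega>) z"
    and A4: "\<exists>c>0. AE \<omega> in M. c < ground_state (J \<omega>) \<and> ground_state (J \<omega>) < 1 / c \<and>
      (\<forall>z\<in>{ground_state (J \<omega>) - c<..<ground_state (J \<omega>) + c}.
        c \<le> Dpot 2 (J \<omega>) z \<and> Dpot 2 (J \<omega>) z \<le> 1 / c \<and> \<bar>Dpot 3 (J \<omega>) z\<bar> \<le> 1 / c)"

text \<open>Only the values of \<open>u\<close> on \<open>{0..1}\<close> matter in all of the following.\<close>

definition deformations :: "nat \<Rightarrow> (real \<Rightarrow> real) set" where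
  "deformations n = {u. continuous_on {0..1} u \<and>
     (\<forall>i<n. \<exists>a b. \<forall>x\<in>{real i / real n<..<(real i + 1) / real n}. u x = a * x + b) \<and>
     mono_on {0..1} u}"

definition deformations_bc :: "nat \<Rightarrow> real \<Rightarrow> (real \<Rightarrow> real) set" where
  "deformations_bc n l = {u \<in> deformations n. u 0 = 0 \<and> u 1 = l}"

definition disc_grad :: "nat \<Rightarrow> (real \<Rightarrow> real) \<Rightarrow> nat \<Rightarrow> real" where
  "disc_grad n u i = real n * (u ((real i + 1) / real n) - u (real i / real n))"

context
  fixes \<tau> :: "int \<Rightarrow> 'a \<Rightarrow> 'a" and J :: "'a \<Rightarrow> real \<Rightarrow> ereal"
begin

definition energy :: "nat \<Rightarrow> 'a \<Rightarrow> (real \<Rightarrow> real) \<Rightarrow> ereal" where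
  "energy n \<omega> u = (\<Sum>i<n. ereal (1 / real n) * J (\<tau> (int i) \<omega>) (disc_grad n u i))"

definition elastic :: "nat \<Rightarrow> 'a \<Rightarrow> (real \<Rightarrow> real) set" where
  "elastic n \<omega> =
    {u \<in> deformations n. \<forall>i<n. ereal (disc_grad n u i) \<le> z_frac (J (\<tau> (int i) \<omega>))}"

text \<open>In \<open>ereal\<close>, the infimum over the empty set is \<open>\<infinity>\<close>.\<close>

definition critical_stretch :: "nat \<Rightarrow> 'a \<Rightarrow> real" where
  "critical_stretch n \<omega> = (GREATEST L. \<forall>l. 0 \<le> l \<and> l < L \<longrightarrow>
     (INF u \<in> elastic n \<omega> \<inter> deformations_bc n l. energy n \<omega> u) =
     (INF u \<in> deformations_bc n l. energy n \<omega> u))"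

definition jump_threshold :: "nat \<Rightarrow> 'a \<Rightarrow> real" where
  "jump_threshold n \<omega> = (critical_stretch n \<omega> - 1) / sqrt (1 / real n)"

end

text \<open>
  \<open>J''(\<omega>, 1)\<close> is specified only for almost every \<open>\<omega>\<close>; on the exceptional null set \<^const>\<open>deriv\<close> is
  an arbitrary value that need not depend measurably on \<open>\<omega>\<close>. The expectation of such an almost
  everywhere defined function is therefore taken with respect to the completed measure.
\<close>

definition alpha_low :: "'a measure \<Rightarrow> ('a \<Rightarrow> real \<Rightarrow> ereal) \<Rightarrow> real" where
  "alpha_low M J = inverse (\<integral>\<omega>. inverse (1 / 2 * Dpot 2 (J \<omega>) 1) \<partial>completion M)"

definition essinf :: "'a measure \<Rightarrow> ('a \<Rightarrow> ereal) \<Rightarrow> ereal" where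
  "essinf M f = - esssup M (\<lambda>\<omega>. - f \<omega>)"

text \<open>Under (A2), \<open>J \<omega> 1\<close> is essentially bounded, so the conversion to \<open>real\<close> loses nothing.\<close>

definition beta :: "'a measure \<Rightarrow> ('a \<Rightarrow> real \<Rightarrow> ereal) \<Rightarrow> real" where
  "beta M J = real_of_ereal (essinf M (\<lambda>\<omega>. - J \<omega> 1))"

end

theory Submission
  imports Defs "HOL-Real_Asymp.Real_Asymp"
begin

text \<open>
  Near \<open>z = 1\<close> every potential is a parabola of curvature \<open>K = J''(\<omega>, 1)\<close>, so by duality the cheapest
  elastic way to stretch \<open>n\<close> bonds by \<open>n d\<close> in total costs \<open>n d\<^sup>2 / (2 m) (1 + O(d))\<close>, where \<open>m\<close> is the
  mean of \<open>1 / K\<close> along the chain. Breaking one bond relaxes all the others and costs about \<open>- J(\<omega>, 1)\<close>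
  at that bond. The two costs balance for \<open>n d\<^sup>2 = 2 m \<beta>\<close>. Birkhoff's theorem gives
  \<open>m \<longrightarrow> 1 / (2 \<alpha>)\<close>, and recurrence provides bonds whose breaking cost is arbitrarily close to \<open>\<beta>\<close>.
  A bond that is broken but still short saves only \<open>O(d)\<close> elastic energy while it pays a fixed
  barrier, so it never competes.
\<close>

section \<open>The ergodic theorem for bounded functions\<close>

text \<open>The critical stretch is defined by an exact equality of infima at each \<open>n\<close>,
  so asymptotic expansions of the two infima would not suffice: below the threshold every
  non-elastic competitor must be matched by an elastic one at finite \<open>n\<close>. This works
  because errors and penalties live on different scales. At \<open>d = g / sqrt n\<close> the
  quadratic elastic cost is of order one, while the errors, cubic thanks to the third-derivative
  bound in (A4), sum to order \<open>n * d ^ 3\<close> and vanish; a fixed barrier absorbs them. The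
  length \<open>R\<close> that separates short from long broken bonds comes from the decay in (A2)
  alone and is fixed before \<open>n\<close>.

  As \<open>1 / J''\<close> is bounded at the ground state, an ergodic theorem for bounded functions
  is enough. Probability only supplies the hypotheses of \<open>ergodic_chain\<close>; what follows
  from them is deterministic.\<close>

context ergodic_shift
begin

lemma shift_space [simp]: "\<omega> \<in> space M \<Longrightarrow> \<tau> i \<omega> \<in> space M"
  using shift_measurable by (rule measurable_space)

lemma shift_inverse:
  assumes "\<omega> \<in> space M"
  shows "\<tau> i (\<tau> (- i) \<omega>) = \<omega>" "\<tau> (- i) (\<tau> i \<omega>) = \<omega>"
  using shift_add[of \<omega> i "- i"] shift_add[of \<omega> "- i" i] shift_0 assms by simp_all

text \<open>Stationarity and ergodicity are assumed for images of sets; invertibility of the shifts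
  turns them into the preimage form used by distributions.\<close>

lemma shift_image:
  assumes "B \<subseteq> space M"
  shows "\<tau> i ` B = \<tau> (- i) -` B \<inter> space M"
proof (intro equalityI subsetI)
  fix \<omega> assume "\<omega> \<in> \<tau> (- i) -` B \<inter> space M"
  then show "\<omega> \<in> \<tau> i ` B" by (auto intro: rev_image_eqI simp: shift_inverse)
qed (use assms shift_inverse in auto)

lemma distr_shift: "distr M M (\<tau> i) = M"
proof (rule measure_eqI)
  fix A assume "A \<in> sets (distr M M (\<tau> i))"
  then have A: "A \<in> sets M" by simp
  have "measure M (\<tau> i -` A \<inter> space M) = measure M A"
    using shift_image[OF sets.sets_into_space[OF A], of "- i"] stationary[OF A, of "- i"] by simp
  then show "emeasure (distr M M (\<tau> i)) A = emeasure M A"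
    using A shift_measurable by (simp add: emeasure_distr emeasure_eq_measure)
qed simp

lemma AE_shift:
  assumes "AE \<omega> in M. P \<omega>"
  shows "AE \<omega> in M. \<forall>i. P (\<tau> i \<omega>)"
  unfolding AE_all_countable using AE_distrD[OF shift_measurable] assms distr_shift by metis

lemma expectation_shift:
  fixes f :: "'a \<Rightarrow> real"
  assumes "f \<in> borel_measurable M"
  shows "expectation (\<lambda>\<omega>. f (\<tau> i \<omega>)) = expectation f"
  using integral_distr[OF shift_measurable assms, of i] distr_shift by simp

section \<open>Birkhoff sums and the maximal ergodic inequality\<close>

definition birkhoff_sum :: "('a \<Rightarrow> real) \<Rightarrow> nat \<Rightarrow> 'a \<Rightarrow> real" where
  "birkhoff_sum f n \<omega> = (\<Sum>k<n. f (\<tau> (int k) \<omega>))"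

lemma shift_Suc: "\<omega> \<in> space M \<Longrightarrow> \<tau> (int (Suc k)) \<omega> = \<tau> (int k) (\<tau> 1 \<omega>)"
  using shift_add[of \<omega> "int k" 1] by (simp add: algebra_simps)

lemma birkhoff_sum_Suc:
  assumes "\<omega> \<in> space M"
  shows "birkhoff_sum f (Suc n) \<omega> = f \<omega> + birkhoff_sum f n (\<tau> 1 \<omega>)"
  unfolding birkhoff_sum_def sum.lessThan_Suc_shift using assms shift_0
  by (simp add: shift_Suc del: of_nat_Suc)

lemma birkhoff_sum_measurable [measurable]:
  assumes "f \<in> borel_measurable M"
  shows "birkhoff_sum f n \<in> borel_measurable M"
  unfolding birkhoff_sum_def[abs_def]
  by (intro borel_measurable_sum measurable_compose[OF shift_measurable assms])

text \<open>The maximum of \<open>0\<close> and the first \<open>n\<close> Birkhoff sums; the recursion is what makes Garsia's proof of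
  the maximal ergodic inequality immediate.\<close>

primrec max_sum :: "('a \<Rightarrow> real) \<Rightarrow> nat \<Rightarrow> 'a \<Rightarrow> real" where
  "max_sum g 0 \<omega> = 0"
| "max_sum g (Suc n) \<omega> = max 0 (g \<omega> + max_sum g n (\<tau> 1 \<omega>))"

lemma max_sum_nonneg: "0 \<le> max_sum g n \<omega>"
  by (cases n) auto

lemma max_sum_mono: "max_sum g n \<omega> \<le> max_sum g (Suc n) \<omega>"
proof (induction n arbitrary: \<omega>)
  case (Suc n)
  then show ?case using Suc[of "\<tau> 1 \<omega>"] by (simp only: max_sum.simps(2)) (intro max.mono; simp)
qed simp

lemma birkhoff_le_max_sum: "\<omega> \<in> space M \<Longrightarrow> birkhoff_sum g n \<omega> \<le> max_sum g n \<omega>"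
proof (induction n arbitrary: \<omega>)
  case (Suc n)
  then show ?case using birkhoff_sum_Suc[of \<omega> g n] by (simp add: le_max_iff_disj)
qed (simp add: birkhoff_sum_def)

lemma max_sum_measurable [measurable]:
  assumes [measurable]: "g \<in> borel_measurable M"
  shows "max_sum g n \<in> borel_measurable M"
proof (induction n)
  case (Suc n)
  have "(\<lambda>\<omega>. max_sum g n (\<tau> 1 \<omega>)) \<in> borel_measurable M"
    by (rule measurable_compose[OF shift_measurable Suc])
  then show ?case by simp
qed simp

lemma max_sum_bounded:
  assumes "\<And>\<omega>. \<omega> \<in> space M \<Longrightarrow> \<bar>g \<omega>\<bar> \<le> C" "\<omega> \<in> space M"
  shows "\<bar>max_sum g n \<omega>\<bar> \<le> n * C"
  using assms(2)
proof (induction n arbitrary: \<omega>)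
  case (Suc n)
  have "\<bar>max_sum g n (\<tau> 1 \<omega>)\<bar> \<le> n * C" "\<bar>g \<omega>\<bar> \<le> C" using Suc assms by auto
  moreover from this have "0 \<le> n * C" "0 \<le> C" by linarith+
  ultimately show ?case by (simp add: algebra_simps)
qed simp

text \<open>Where \<open>max_sum g n\<close> is positive, it equals \<open>g\<close> plus the
  previous maximum after a shift, hence is at most \<open>g\<close> plus \<open>max_sum g n\<close>
  after a shift; elsewhere it vanishes. The shift preserves its mean, so integrating the difference
  gives the claim.\<close>

lemma maximal_ergodic_inequality:
  assumes [measurable]: "g \<in> borel_measurable M"
    and bd: "\<And>\<omega>. \<omega> \<in> space M \<Longrightarrow> \<bar>g \<omega>\<bar> \<le> C"
  shows "0 \<le> expectation (\<lambda>\<omega>. g \<omega> * indicator {\<omega>. 0 < max_sum g n \<omega>} \<omega>)"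
proof (cases n)
  case (Suc m)
  have C: "0 \<le> C" using bd not_empty by (meson abs_ge_zero equals0I order_trans)
  let ?A = "{\<omega>. 0 < max_sum g n \<omega>}"
  have [measurable]: "(\<lambda>\<omega>. max_sum g n (\<tau> 1 \<omega>)) \<in> borel_measurable M"
    by (rule measurable_compose[OF shift_measurable]) measurable
  have int: "integrable M (max_sum g n)" "integrable M (\<lambda>\<omega>. max_sum g n (\<tau> 1 \<omega>))"
    by (rule integrable_const_bound[of _ "n * C"]; use max_sum_bounded[OF bd] in simp)+
  have "0 = expectation (\<lambda>\<omega>. max_sum g n \<omega> - max_sum g n (\<tau> 1 \<omega>))"
    using int by (simp add: expectation_shift[of "max_sum g n"])
  also have "\<dots> \<le> expectation (\<lambda>\<omega>. g \<omega> * indicator ?A \<omega>)"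
  proof (rule integral_mono)
    show "integrable M (\<lambda>\<omega>. g \<omega> * indicator ?A \<omega>)"
      by (rule integrable_const_bound[of _ C]) (use bd C in \<open>auto simp: indicator_def\<close>)
  next
    fix \<omega> assume "\<omega> \<in> space M"
    have "max_sum g m (\<tau> 1 \<omega>) \<le> max_sum g n (\<tau> 1 \<omega>)"
      using max_sum_mono[of g m] Suc by simp
    then show "max_sum g n \<omega> - max_sum g n (\<tau> 1 \<omega>) \<le> g \<omega> * indicator ?A \<omega>"
      using max_sum_nonneg[of g n "\<tau> 1 \<omega>"] Suc by (auto simp: indicator_def)
  qed (use int in simp)
  finally show ?thesis .
qed simp

text \<open>The sets where \<open>max_sum g n\<close> is positive increase with \<open>n\<close> and
  exhaust the space up to a null set; dominated convergence does the rest.\<close>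

lemma expectation_nonneg_if_sums_positive:
  assumes [measurable]: "g \<in> borel_measurable M"
    and bd: "\<And>\<omega>. \<omega> \<in> space M \<Longrightarrow> \<bar>g \<omega>\<bar> \<le> C"
    and pos: "AE \<omega> in M. \<exists>n. 0 < birkhoff_sum g n \<omega>"
  shows "0 \<le> expectation g"
proof (rule LIMSEQ_le_const)
  show "\<exists>N. \<forall>n\<ge>N. 0 \<le> expectation (\<lambda>\<omega>. g \<omega> * indicator {\<omega>. 0 < max_sum g n \<omega>} \<omega>)"
    using maximal_ergodic_inequality assms by blast
  show "(\<lambda>n. expectation (\<lambda>\<omega>. g \<omega> * indicator {\<omega>. 0 < max_sum g n \<omega>} \<omega>)) \<longlonglongrightarrow> expectation g"
  proof (rule integral_dominated_convergence[where w = "\<lambda>_. C"])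
    show "AE \<omega> in M. (\<lambda>n. g \<omega> * indicator {\<omega>. 0 < max_sum g n \<omega>} \<omega>) \<longlonglongrightarrow> g \<omega>"
      using pos AE_space
    proof eventually_elim
      case (elim \<omega>)
      then obtain n where n: "0 < birkhoff_sum g n \<omega>" by blast
      have "0 < max_sum g k \<omega>" if "n \<le> k" for k
        using n birkhoff_le_max_sum[OF elim(2), of g n]
          lift_Suc_mono_le[of "\<lambda>k. max_sum g k \<omega>", OF max_sum_mono that] by linarith
      then have "\<forall>\<^sub>F k in sequentially. g \<omega> * indicator {\<omega>. 0 < max_sum g k \<omega>} \<omega> = g \<omega>"
        unfolding eventually_sequentially by (intro exI[of _ n]) simp
      then show ?case by (rule tendsto_eventually)
    qed
    show "AE \<omega> in M. norm (g \<omega> * indicator {\<omega>. 0 < max_sum g n \<omega>} \<omega>) \<le> C" for n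
      using bd by (intro AE_I2) (auto simp: indicator_def intro: order_trans[OF abs_ge_zero])
  qed auto
qed

section \<open>Pointwise convergence of averages\<close>

definition upper_average :: "('a \<Rightarrow> real) \<Rightarrow> 'a \<Rightarrow> ereal" where
  "upper_average f \<omega> = limsup (\<lambda>n. ereal (birkhoff_sum f n \<omega> / n))"

lemma upper_average_measurable [measurable]:
  assumes [measurable]: "f \<in> borel_measurable M"
  shows "upper_average f \<in> borel_measurable M"
  unfolding upper_average_def[abs_def] by measurable

text \<open>Shifting by one drops the first summand and appends a new one, which moves the average
  by at most \<open>2 * C / n\<close>. Negative shifts are the same identity read backwards along
  the orbit.\<close>

lemma upper_average_shift:
  assumes bd: "\<And>\<omega>. \<omega> \<in> space M \<Longrightarrow> \<bar>f \<omega>\<bar> \<le> C" and "\<omega> \<in> space M"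
  shows "upper_average f (\<tau> i \<omega>) = upper_average f \<omega>"
proof -
  have step: "upper_average f (\<tau> 1 \<omega>) = upper_average f \<omega>" if \<omega>: "\<omega> \<in> space M" for \<omega>
  proof -
    define u where "u n = (f (\<tau> (int n) \<omega>) - f \<omega>) / n" for n :: nat
    have "u \<longlonglongrightarrow> 0"
    proof (rule Lim_null_comparison)
      show "\<forall>\<^sub>F n in sequentially. norm (u n) \<le> 2 * C / n"
      proof (rule always_eventually, rule allI)
        fix n
        have "\<bar>f (\<tau> (int n) \<omega>) - f \<omega>\<bar> \<le> 2 * C"
          using bd[of \<omega>] bd[of "\<tau> (int n) \<omega>"] \<omega> by (simp add: abs_le_iff)
        then show "norm (u n) \<le> 2 * C / n" unfolding u_def by (simp add: divide_right_mono)
      qed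
      show "(\<lambda>n. 2 * C / n) \<longlonglongrightarrow> 0" by (rule lim_const_over_n)
    qed
    then have u: "(\<lambda>n. ereal (u n)) \<longlonglongrightarrow> 0" by (simp add: zero_ereal_def)
    have *: "ereal (birkhoff_sum f n (\<tau> 1 \<omega>) / n) = ereal (u n) + ereal (birkhoff_sum f n \<omega> / n)" for n
      using birkhoff_sum_Suc[OF \<omega>, of f n]
      by (simp add: birkhoff_sum_def u_def add_divide_distrib[symmetric])
    show ?thesis
      unfolding upper_average_def * by (subst ereal_limsup_lim_add[OF u]) simp_all
  qed
  show ?thesis
  proof (induction i rule: int_induct[where k = 0])
    case (step1 i)
    then show ?case using step[of "\<tau> i \<omega>"] shift_add[of \<omega> 1 i] assms(2) by (simp add: add.commute)
  next
    case (step2 i)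
    then show ?case using step[of "\<tau> (i - 1) \<omega>"] shift_add[of \<omega> 1 "i - 1"] assms(2) by simp
  qed (use shift_0 assms in simp)
qed

text \<open>The set \<open>B\<close> where the bound fails is invariant, hence null or of full
  measure. Full measure would give \<open>f - a\<close> a positive Birkhoff sum almost everywhere,
  hence a nonnegative mean, against \<open>expectation f < a\<close>.\<close>

lemma upper_average_le:
  assumes [measurable]: "f \<in> borel_measurable M"
    and bd: "\<And>\<omega>. \<omega> \<in> space M \<Longrightarrow> \<bar>f \<omega>\<bar> \<le> C" and a: "expectation f < a"
  shows "AE \<omega> in M. upper_average f \<omega> \<le> ereal a"
proof -
  define B where "B = {\<omega> \<in> space M. ereal a < upper_average f \<omega>}"
  have B [measurable]: "B \<in> sets M" unfolding B_def by measurable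
  have "\<tau> i ` B = B" for i
    unfolding shift_image[of B i, OF sets.sets_into_space[OF B]]
    using upper_average_shift[OF bd] by (auto simp: B_def)
  then consider "prob B = 0" | "prob B = 1" using ergodic[OF B] by blast
  then show ?thesis
  proof cases
    case 1
    then have "AE \<omega> in M. \<omega> \<notin> B" using prob_eq_0[OF B] by simp
    then show ?thesis using AE_space by eventually_elim (auto simp: B_def)
  next
    case 2
    then have "AE \<omega> in M. \<omega> \<in> B" using prob_eq_1[OF B] by simp
    then have "AE \<omega> in M. \<exists>n. 0 < birkhoff_sum (\<lambda>\<omega>. f \<omega> - a) n \<omega>"
    proof eventually_elim
      case (elim \<omega>)
      have "\<exists>n>0. a < birkhoff_sum f n \<omega> / n"
      proof (rule ccontr)
        assume "\<not> ?thesis"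
        then have "\<forall>n>0. birkhoff_sum f n \<omega> / n \<le> a" by (metis not_less)
        then have "upper_average f \<omega> \<le> ereal a"
          unfolding upper_average_def
          by (intro Limsup_bounded) (auto simp: eventually_sequentially intro!: exI[of _ 1])
        then show False using elim by (auto simp: B_def)
      qed
      then obtain n where "0 < n" "a < birkhoff_sum f n \<omega> / n" by blast
      then show ?case
        by (intro exI[of _ n]) (simp add: birkhoff_sum_def sum_subtractf field_simps)
    qed
    moreover have "\<bar>f \<omega> - a\<bar> \<le> C + \<bar>a\<bar>" if "\<omega> \<in> space M" for \<omega>
      using bd[OF that] by linarith
    ultimately have "0 \<le> expectation (\<lambda>\<omega>. f \<omega> - a)"
      by (intro expectation_nonneg_if_sums_positive[where C = "C + \<bar>a\<bar>"]) auto
    moreover have "integrable M f" by (rule integrable_const_bound[of _ C]) (use bd in auto)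
    ultimately show ?thesis using a by (simp add: prob_space)
  qed
qed

theorem birkhoff_bounded:
  assumes [measurable]: "f \<in> borel_measurable M"
    and bd: "\<And>\<omega>. \<omega> \<in> space M \<Longrightarrow> \<bar>f \<omega>\<bar> \<le> C"
  shows "AE \<omega> in M. (\<lambda>n. birkhoff_sum f n \<omega> / n) \<longlonglongrightarrow> expectation f"
proof -
  have upper: "AE \<omega> in M. \<forall>a > expectation g. \<forall>\<^sub>F n in sequentially. birkhoff_sum g n \<omega> / n < a"
    if [measurable]: "g \<in> borel_measurable M" and g: "\<And>\<omega>. \<omega> \<in> space M \<Longrightarrow> \<bar>g \<omega>\<bar> \<le> C" for g
  proof -
    \<comment> \<open>Countably many levels, so that the null set does not depend on
      \<open>a\<close>.\<close>
    have "AE \<omega> in M. \<forall>k. upper_average g \<omega> \<le> ereal (expectation g + 1 / real (Suc k))"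
      unfolding AE_all_countable by (intro allI upper_average_le[OF _ g]) auto
    then show ?thesis
    proof eventually_elim
      case (elim \<omega>)
      show ?case
      proof (intro allI impI)
        fix a assume "expectation g < a"
        then obtain k where "1 / real (Suc k) < a - expectation g"
          using nat_approx_posE[of "a - expectation g"] by auto
        then have "upper_average g \<omega> < ereal a"
          by (intro le_less_trans[OF elim[rule_format, of k]]) simp
        then show "\<forall>\<^sub>F n in sequentially. birkhoff_sum g n \<omega> / n < a"
          unfolding upper_average_def by (drule_tac Limsup_lessD) simp
      qed
    qed
  qed
  have "AE \<omega> in M. \<forall>a > expectation (\<lambda>\<omega>. - f \<omega>).
      \<forall>\<^sub>F n in sequentially. birkhoff_sum (\<lambda>\<omega>. - f \<omega>) n \<omega> / n < a"
    by (rule upper) (use bd in auto)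
  moreover have "AE \<omega> in M. \<forall>a > expectation f. \<forall>\<^sub>F n in sequentially. birkhoff_sum f n \<omega> / n < a"
    by (rule upper) (use bd in auto)
  ultimately show ?thesis
  proof eventually_elim
    case (elim \<omega>)
    have neg: "birkhoff_sum (\<lambda>\<omega>. - f \<omega>) n \<omega> = - birkhoff_sum f n \<omega>" for n
      by (simp add: birkhoff_sum_def sum_negf)
    show ?case
    proof (rule order_tendstoI)
      fix a assume "a < expectation f"
      then show "\<forall>\<^sub>F n in sequentially. a < birkhoff_sum f n \<omega> / n"
        using elim(1)[rule_format, of "- a"] by (simp add: neg)
    qed (use elim(2) in blast)
  qed
qed

text \<open>If the orbit missed \<open>B\<close>, every average of its indicator would vanish,
  whereas their limit is \<open>prob B\<close>.\<close>

lemma recurrence: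
  assumes B [measurable]: "B \<in> sets M" and pos: "0 < prob B"
  shows "AE \<omega> in M. \<exists>k. \<tau> (int k) \<omega> \<in> B"
proof -
  have "AE \<omega> in M. (\<lambda>n. birkhoff_sum (indicator B) n \<omega> / n) \<longlonglongrightarrow> expectation (indicator B)"
    by (rule birkhoff_bounded[where C = 1]) (auto simp: indicator_def)
  then show ?thesis
  proof eventually_elim
    case (elim \<omega>)
    show ?case
    proof (rule ccontr)
      assume "\<not> ?thesis"
      then have "birkhoff_sum (indicator B) n \<omega> = 0" for n
        by (simp add: birkhoff_sum_def)
      then show False using elim pos LIMSEQ_unique[OF elim, of 0] by (simp add: measure_space_inter)
    qed
  qed
qed

end

section \<open>A single potential\<close>

text \<open>The almost sure properties of one potential, with the ground state already placed at 1
  and \<open>c\<close> from (A4). \<open>c_less_1\<close> is the bound of (A4) on the ground state;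
  \<open>min_at_1\<close> and \<open>strict_min\<close> express the unique minimizer.\<close>

locale fracture_potential =
  fixes V :: "real \<Rightarrow> ereal" and c :: real
  assumes c_pos: "0 < c" and c_less_1: "c < 1"
    and smooth: "C3_pos V"
    and infinite_nonpos: "\<And>z. z \<le> 0 \<Longrightarrow> V z = \<infinity>"
    and z_frac_pos: "z_frac V > 0"
    and mono_past_frac: "mono_on {z. z_frac V \<le> ereal z} V"
    and min_at_1: "\<And>z. V 1 \<le> V z"
    and strict_min: "\<And>z. V z \<le> V 1 \<Longrightarrow> z = 1"
    and D2_bounds: "\<And>z. \<bar>z - 1\<bar> < c \<Longrightarrow> c \<le> Dpot 2 V z \<and> Dpot 2 V z \<le> 1 / c"
    and D3_bound: "\<And>z. \<bar>z - 1\<bar> < c \<Longrightarrow> \<bar>Dpot 3 V z\<bar> \<le> 1 / c"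
begin

definition v :: "real \<Rightarrow> real" where "v z = real_of_ereal (V z)"
definition K :: real where "K = Dpot 2 V 1"

lemma V_eq: "z > 0 \<Longrightarrow> V z = ereal (v z)"
  using smooth unfolding C3_pos_def v_def by (simp add: ereal_real)

lemma DERIV_Dpot: "k < 3 \<Longrightarrow> z > 0 \<Longrightarrow> (Dpot k V has_real_derivative Dpot (Suc k) V z) (at z)"
  using smooth unfolding C3_pos_def
  by (metis DERIV_deriv_iff_field_differentiable Dpot_def comp_apply funpow.simps(2))

lemma Dpot_0: "Dpot 0 V = v"
  by (simp add: Dpot_def v_def[abs_def])

lemma v_min: "z > 0 \<Longrightarrow> v 1 \<le> v z"
  using min_at_1[of z] V_eq[of z] V_eq[of 1] by simp

lemma D1_at_1: "Dpot 1 V 1 = 0"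
proof (rule DERIV_local_min)
  show "(v has_real_derivative Dpot 1 V 1) (at 1)"
    using DERIV_Dpot[of 0 1] by (simp add: Dpot_0)
  show "\<forall>y. \<bar>1 - y\<bar> < 1 \<longrightarrow> v 1 \<le> v y"
    using v_min by force
qed simp

lemma D2_pos_below_frac:
  assumes "0 < x" "ereal x < z_frac V"
  shows "Dpot 2 V x > 0"
  using assms unfolding z_frac_def less_Sup_iff by auto

text \<open>If fracture occurred before 1, (A3) would make \<open>V\<close> increasing up to 1 from
  some \<open>z < 1\<close>, against strict minimality. Beyond 1, (A4) continues the
  convexity.\<close>

lemma z_frac_ge: "ereal (1 + c) \<le> z_frac V"
proof -
  have one: "1 \<le> z_frac V"
  proof (rule ccontr)
    assume "\<not> 1 \<le> z_frac V"
    then obtain z where z: "z_frac V < ereal z" "z < 1"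
      by (metis ereal_dense2 linorder_not_le one_ereal_def less_ereal.simps(1))
    have "V z \<le> V 1"
      by (rule mono_onD[OF mono_past_frac]) (use z in \<open>auto intro: less_imp_le order_trans[of _ "ereal z"]\<close>)
    then show False using strict_min z by auto
  qed
  have "1 + c \<in> {z. z > 0 \<and> (\<forall>s\<in>{0<..<z}. Dpot 2 V s > 0)}"
  proof safe
    show "0 < 1 + c" using c_pos by simp
    fix s assume s: "s \<in> {0<..<1 + c}"
    show "Dpot 2 V s > 0"
    proof (cases "s < 1")
      case True
      then have "ereal s < z_frac V"
        using one by (metis ereal_less(3) less_le_trans one_ereal_def less_ereal.simps(1))
      then show ?thesis using D2_pos_below_frac s by simp
    next
      case False
      then show ?thesis using D2_bounds[of s] s c_pos by force
    qed
  qed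
  then show ?thesis unfolding z_frac_def by (intro Sup_upper imageI)
qed

lemma D1_mono_below_frac:
  assumes "0 < x" "x \<le> y" "ereal y < z_frac V"
  shows "Dpot 1 V x \<le> Dpot 1 V y"
proof (rule DERIV_nonneg_imp_nondecreasing[OF assms(2)])
  fix t assume t: "x \<le> t" "t \<le> y"
  then have "ereal t < z_frac V" by (intro le_less_trans[OF _ assms(3)]) simp
  then have "Dpot 2 V t > 0" using t assms by (intro D2_pos_below_frac) auto
  moreover have "(Dpot 1 V has_real_derivative Dpot 2 V t) (at t)"
    using DERIV_Dpot[of 1 t] t assms by (simp add: numeral_2_eq_2)
  ultimately show "\<exists>d. (Dpot 1 V has_real_derivative d) (at t) \<and> 0 \<le> d"
    by (intro exI[of _ "Dpot 2 V t"]) auto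
qed

lemma v_MVT:
  assumes "0 < x" "x < y"
  obtains t where "x < t" "t < y" "v y - v x = (y - x) * Dpot 1 V t"
proof -
  have "\<exists>t. t > x \<and> t < y \<and> v y - v x = (y - x) * Dpot 1 V t"
    by (rule MVT2[OF assms(2)]) (use DERIV_Dpot[of 0] assms in \<open>auto simp: Dpot_0\<close>)
  then show thesis using that by blast
qed

lemma one_less_z_frac: "1 < z_frac V"
  by (rule less_le_trans[OF _ z_frac_ge]) (use c_pos in simp)

lemma v_antimono:
  assumes "0 < x" "x \<le> y" "y \<le> 1"
  shows "v y \<le> v x"
proof (cases "x = y")
  case False
  then obtain t where t: "x < t" "t < y" "v y - v x = (y - x) * Dpot 1 V t"
    using v_MVT[of x y] assms by auto
  have "Dpot 1 V t \<le> 0"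
    using D1_mono_below_frac[of t 1] one_less_z_frac D1_at_1 t assms by (simp add: one_ereal_def)
  then have "(y - x) * Dpot 1 V t \<le> 0" using t by (simp add: mult_nonneg_nonpos)
  then show ?thesis using t by simp
qed simp

lemma v_mono:
  assumes "1 \<le> x" "x \<le> y"
  shows "v x \<le> v y"
proof -
  have below: "v x \<le> v y" if xy: "1 \<le> x" "x \<le> y" "ereal y \<le> z_frac V" for x y
  proof (cases "x = y")
    case False
    then obtain t where t: "x < t" "t < y" "v y - v x = (y - x) * Dpot 1 V t"
      using v_MVT[of x y] xy by auto
    have "ereal t < z_frac V" using t by (intro less_le_trans[OF _ xy(3)]) simp
    then have "0 \<le> Dpot 1 V t"
      using D1_mono_below_frac[of 1 t] D1_at_1 t xy by simp
    then have "0 \<le> (y - x) * Dpot 1 V t" using t by simp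
    then show ?thesis using t by simp
  qed simp
  have above: "v x \<le> v y" if "1 \<le> x" "x \<le> y" "z_frac V \<le> ereal x" for x y
  proof -
    have "V x \<le> V y"
      by (rule mono_onD[OF mono_past_frac]) (use that in \<open>auto intro: order_trans[of _ "ereal x"]\<close>)
    then show ?thesis using V_eq that by simp
  qed
  show ?thesis
  proof (cases "ereal x \<le> z_frac V \<and> z_frac V \<le> ereal y")
    case True
    then obtain f where f: "z_frac V = ereal f" by (cases "z_frac V") auto
    have "v x \<le> v f" using below[of x f] assms True f by simp
    also have "v f \<le> v y" using above[of f y] assms True f by simp
    finally show ?thesis .
  next
    case False
    then show ?thesis using below[of x y] above[of x y] assms by auto
  qed
qed

section \<open>Quantitative bounds at the well and past the barrier\<close>

lemma K_bounds: "c \<le> K" "K \<le> 1 / c"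
  using D2_bounds[of 1] c_pos by (auto simp: K_def)

text \<open>Taylor expansion with \<open>V''\<close> at an intermediate point, which differs from
  \<open>K\<close> by at most \<open>h / c\<close>. As \<open>K\<close> is at least
  \<open>c\<close>, this is at most \<open>K * (h / c\<^sup>2)\<close>: a relative error, so one
  factor serves all bonds whatever their curvature.\<close>

lemma quadratic_bounds:
  assumes "0 \<le> h" "h < c"
  shows "1/2 * K * (1 - h / c\<^sup>2) * h\<^sup>2 \<le> v (1 + h) - v 1"
    and "v (1 + h) - v 1 \<le> 1/2 * K * (1 + h / c\<^sup>2) * h\<^sup>2"
proof -
  have "1/2 * K * (1 - h / c\<^sup>2) * h\<^sup>2 \<le> v (1 + h) - v 1 \<and>
    v (1 + h) - v 1 \<le> 1/2 * K * (1 + h / c\<^sup>2) * h\<^sup>2"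
  proof (cases "h = 0")
    case False
    then have h: "0 < h" using assms by simp
    have "\<exists>t>1. t < 1 + h \<and> v (1 + h) = (\<Sum>m<2. Dpot m V 1 / fact m * (1 + h - 1) ^ m) +
        Dpot 2 V t / fact 2 * (1 + h - 1) ^ 2"
      by (rule Taylor_up[where a = 1 and b = "1 + h"])
        (use h DERIV_Dpot in \<open>auto simp: Dpot_0\<close>)
    then obtain t where t: "1 < t" "t < 1 + h" and vt: "v (1 + h) - v 1 = Dpot 2 V t / 2 * h\<^sup>2"
      using D1_at_1 Dpot_0 by (auto simp: numeral_2_eq_2 lessThan_Suc fact_numeral)
    have "\<exists>s. s > 1 \<and> s < t \<and> Dpot 2 V t - Dpot 2 V 1 = (t - 1) * Dpot 3 V s"
      by (rule MVT2[OF t(1)]) (use DERIV_Dpot[of 2] in \<open>auto simp: numeral_3_eq_3 numeral_2_eq_2\<close>)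
    then obtain s where s: "1 < s" "s < t" "Dpot 2 V t - K = (t - 1) * Dpot 3 V s"
      by (auto simp: K_def)
    have "\<bar>Dpot 2 V t - K\<bar> \<le> h * (1 / c)"
      unfolding s(3) abs_mult using s t assms D3_bound[of s] by (intro mult_mono) auto
    also have "h * (1 / c) \<le> K * (h / c\<^sup>2)"
      using mult_right_mono[OF K_bounds(1), of "h / c\<^sup>2"] h c_pos by (simp add: power2_eq_square)
    finally have "K * (1 - h / c\<^sup>2) \<le> Dpot 2 V t" "Dpot 2 V t \<le> K * (1 + h / c\<^sup>2)"
      by (auto simp: algebra_simps)
    from this[THEN mult_right_mono, of "h\<^sup>2 / 2"] show ?thesis
      unfolding vt by (simp add: mult_ac)
  qed simp
  then show "1/2 * K * (1 - h / c\<^sup>2) * h\<^sup>2 \<le> v (1 + h) - v 1"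
    and "v (1 + h) - v 1 \<le> 1/2 * K * (1 + h / c\<^sup>2) * h\<^sup>2" by auto
qed

text \<open>A Legendre-Fenchel inequality: \<open>s\<^sup>2 / (2 * q * K)\<close> is the conjugate
  of the parabola of curvature \<open>q * K\<close>. Left of 1 the left side is nonpositive; up to
  \<open>1 + r\<close> the parabola lies below the energy; beyond, convexity keeps the slope above
  \<open>s\<close>, which is what the upper bound on \<open>s\<close> ensures.\<close>

lemma elastic_lower_bound:
  assumes r: "0 < r" "r < c" and q: "q = 1 - r / c\<^sup>2" "0 < q"
    and s: "0 \<le> s" "s \<le> 1/2 * q * K * r"
    and z: "0 < z" "ereal z \<le> z_frac V"
  shows "s * (z - 1) - s\<^sup>2 / (2 * q * K) \<le> v z - v 1"
proof -
  have qK: "0 < q * K" using q K_bounds c_pos by simp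
  then have pos: "0 \<le> s\<^sup>2 / (2 * q * K)" by simp
  consider "z \<le> 1" | "1 < z" "z \<le> 1 + r" | "1 + r < z" by linarith
  then show ?thesis
  proof cases
    case 1
    then have "s * (z - 1) \<le> 0" using s by (simp add: mult_nonneg_nonpos)
    then show ?thesis using pos v_min[of z] z by linarith
  next
    case 2
    define h where "h = z - 1"
    have h: "0 \<le> h" "h \<le> r" "h < c" "z = 1 + h" using 2 r by (auto simp: h_def)
    \<comment> \<open>Completing the square: Young's inequality for \<open>s * h\<close>.\<close>
    have "0 \<le> (q * K * h - s)\<^sup>2 / (2 * (q * K))" using qK by simp
    also have "\<dots> = 1/2 * K * q * h\<^sup>2 - s * h + s\<^sup>2 / (2 * q * K)"
      using q(2) K_bounds c_pos by (simp add: power2_eq_square field_simps)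
    finally have "s * h - s\<^sup>2 / (2 * q * K) \<le> 1/2 * K * q * h\<^sup>2" by simp
    also have "\<dots> \<le> 1/2 * K * (1 - h / c\<^sup>2) * h\<^sup>2"
      using h K_bounds c_pos q by (intro mult_right_mono mult_left_mono) (auto simp: divide_right_mono)
    also have "\<dots> \<le> v z - v 1" using quadratic_bounds(1)[of h] h by simp
    finally show ?thesis by (simp add: h_def)
  next
    case 3
    obtain x where x: "1 < x" "x < 1 + r" "v (1 + r) - v 1 = r * Dpot 1 V x"
      using v_MVT[of 1 "1 + r"] r by auto
    obtain y where y: "1 + r < y" "y < z" "v z - v (1 + r) = (z - (1 + r)) * Dpot 1 V y"
      using v_MVT[of "1 + r" z] r 3 by auto
    have "ereal y < z_frac V" using y by (intro less_le_trans[OF _ z(2)]) simp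
    then have xy: "Dpot 1 V x \<le> Dpot 1 V y" using x y by (intro D1_mono_below_frac) auto
    \<comment> \<open>The mean slope of \<open>v\<close> over the window, attained at
      \<open>x\<close>, is at least \<open>s\<close>.\<close>
    have "s * r \<le> (1/2 * q * K * r) * r" using s r by (intro mult_right_mono) auto
    also have "\<dots> = 1/2 * K * (1 - r / c\<^sup>2) * r\<^sup>2" using q by (simp add: power2_eq_square)
    also have "\<dots> \<le> r * Dpot 1 V x" using quadratic_bounds(1)[of r] r x by simp
    finally have sx: "s \<le> Dpot 1 V x" using r by (simp add: mult.commute)
    have "s * (z - 1) = (z - (1 + r)) * s + r * s" by (simp add: algebra_simps)
    also have "\<dots> \<le> (z - (1 + r)) * Dpot 1 V y + r * Dpot 1 V x"
      using sx xy 3 r by (intro add_mono mult_left_mono) auto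
    also have "\<dots> = v z - v 1" using x y by simp
    finally show ?thesis using pos by linarith
  qed
qed

text \<open>By monotonicity it is enough to treat \<open>1 + h\<close> with
  \<open>h = c\<^sup>2 / 2\<close>, the value at which the factor \<open>1 - h / c\<^sup>2\<close>
  of the quadratic bound is one half.\<close>

lemma barrier_lower_bound:
  assumes "1 + c\<^sup>2 / 2 \<le> z"
  shows "c ^ 5 / 16 \<le> v z - v 1"
proof -
  define h where "h = c\<^sup>2 / 2"
  have c2: "c\<^sup>2 < c" using c_pos c_less_1 by (simp add: power2_eq_square)
  have h: "0 \<le> h" "h < c" using c_pos c2 by (auto simp: h_def)
  have "c ^ 5 / 16 = 1/2 * c * (1/2) * h\<^sup>2" by (simp add: h_def eval_nat_numeral)
  also have "\<dots> \<le> 1/2 * K * (1/2) * h\<^sup>2" using K_bounds by (intro mult_right_mono) auto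
  also have "\<dots> = 1/2 * K * (1 - h / c\<^sup>2) * h\<^sup>2" using c_pos by (simp add: h_def)
  also have "\<dots> \<le> v (1 + h) - v 1" using h by (intro quadratic_bounds)
  also have "\<dots> \<le> v z - v 1" using v_mono[of "1 + h" z] assms h by (simp add: h_def)
  finally show ?thesis .
qed

lemma broken_lower_bound:
  assumes "z_frac V < ereal z"
  shows "c ^ 5 / 16 \<le> v z - v 1"
proof (rule barrier_lower_bound)
  have "ereal (1 + c) < ereal z" using z_frac_ge assms by (rule le_less_trans)
  moreover have "c\<^sup>2 < c" using c_pos c_less_1 by (simp add: power2_eq_square)
  ultimately show "1 + c\<^sup>2 / 2 \<le> z" using c_pos by simp
qed

end

section \<open>Chains of finite length\<close>

locale potential_chain =
  fixes V :: "nat \<Rightarrow> real \<Rightarrow> ereal" and c :: real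
  assumes potential: "fracture_potential (V i) c"
begin

sublocale P: fracture_potential "V i" c for i
  by (rule potential)

lemmas c_pos = P.c_pos and c_less_1 = P.c_less_1

definition chain_energy :: "nat \<Rightarrow> (nat \<Rightarrow> real) \<Rightarrow> ereal" where
  "chain_energy n z = (\<Sum>i<n. ereal (1 / real n) * V i (z i))"

text \<open>Left without the factor \<open>1 / n\<close>: at mean stretch \<open>1 + d\<close> with
  \<open>d\<close> of order \<open>1 / sqrt n\<close> the minimal excess is of order one, the scale
  of a single broken bond.\<close>

definition excess :: "nat \<Rightarrow> (nat \<Rightarrow> real) \<Rightarrow> real" where
  "excess n z = (\<Sum>i<n. P.v i (z i) - P.v i 1)"

definition gradients :: "nat \<Rightarrow> real \<Rightarrow> (nat \<Rightarrow> real) set" where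
  "gradients n l = {z. (\<forall>i<n. 0 \<le> z i) \<and> (\<Sum>i<n. z i) = real n * l}"

definition elastic_gradients :: "nat \<Rightarrow> (nat \<Rightarrow> real) set" where
  "elastic_gradients n = {z. \<forall>i<n. ereal (z i) \<le> z_frac (V i)}"

definition elastic_optimal :: "nat \<Rightarrow> real \<Rightarrow> bool" where
  "elastic_optimal n l \<longleftrightarrow>
    (INF z \<in> elastic_gradients n \<inter> gradients n l. chain_energy n z) =
    (INF z \<in> gradients n l. chain_energy n z)"

definition mean_compliance :: "nat \<Rightarrow> real" where
  "mean_compliance n = (\<Sum>i<n. 1 / P.K i) / real n"

lemma chain_energy_pos:
  assumes "\<And>i. i < n \<Longrightarrow> 0 < z i"
  shows "chain_energy n z = ereal (((\<Sum>i<n. P.v i 1) + excess n z) / real n)"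
proof -
  have "chain_energy n z = (\<Sum>i<n. ereal (1 / real n * P.v i (z i)))"
    unfolding chain_energy_def using assms by (intro sum.cong) (auto simp: P.V_eq)
  also have "\<dots> = ereal ((\<Sum>i<n. P.v i (z i)) / real n)"
    by (simp add: sum_divide_distrib)
  finally show ?thesis by (simp add: excess_def sum_subtractf)
qed

lemma chain_energy_nonpos:
  assumes "i < n" "z i \<le> 0"
  shows "chain_energy n z = \<infinity>"
  unfolding chain_energy_def sum_Pinfty using assms P.infinite_nonpos by force

lemma elastic_optimalI:
  assumes "\<And>z. z \<in> gradients n l \<Longrightarrow>
    \<exists>w \<in> elastic_gradients n \<inter> gradients n l. chain_energy n w \<le> chain_energy n z"
  shows "elastic_optimal n l"
  unfolding elastic_optimal_def by (rule INF_eq) (use assms in auto)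

text \<open>Bonds beyond 1 are cut back to 1, then all bonds are moved towards 1 by a common
  fraction to restore the total length. No bond gains energy, as \<open>v\<close> is antitone up to
  1.\<close>

lemma elastic_optimal_compressed:
  assumes n: "0 < n" and l: "l \<le> 1"
  shows "elastic_optimal n l"
proof (rule elastic_optimalI)
  fix z assume z: "z \<in> gradients n l"
  define y where "y i = min (z i) 1" for i
  define S where "S = (\<Sum>i<n. y i)"
  \<comment> \<open>If \<open>S = n\<close>, division by zero gives \<open>t = 0\<close>; this is
    right, because then \<open>n * l = n\<close> too.\<close>
  define t where "t = (n * l - S) / (n - S)"
  define w where "w i = y i + t * (1 - y i)" for i
  have "S \<le> (\<Sum>i<n. z i)" unfolding S_def by (rule sum_mono) (simp add: y_def)
  then have S: "S \<le> n * l" using z by (simp add: gradients_def)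
  have "n * l \<le> n" using l n by simp
  then have t: "0 \<le> t" "t \<le> 1" and St: "S + t * (n - S) = n * l"
    using S by (auto simp: t_def divide_le_eq_1 intro: divide_nonneg_nonneg)
  have y: "0 \<le> y i" "y i \<le> 1" if "i < n" for i using z that by (auto simp: y_def gradients_def)
  have w: "y i \<le> w i" "w i \<le> 1" if "i < n" for i
  proof -
    show "y i \<le> w i" unfolding w_def using y[OF that] t by simp
    have "t * (1 - y i) \<le> 1 * (1 - y i)" using y[OF that] t by (intro mult_right_mono) auto
    then show "w i \<le> 1" unfolding w_def by simp
  qed
  have "(\<Sum>i<n. w i) = S + t * (n - S)"
    by (simp add: w_def S_def sum.distrib sum_distrib_left[symmetric] sum_subtractf)
  then have "w \<in> gradients n l" using w y St by (auto simp: gradients_def intro: order_trans)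
  moreover have "w \<in> elastic_gradients n"
  proof -
    have "ereal (w i) \<le> z_frac (V i)" if "i < n" for i
      using w[OF that] P.one_less_z_frac[of i]
      by (intro order_trans[OF _ less_imp_le[OF P.one_less_z_frac]]) (simp add: one_ereal_def)
    then show ?thesis by (auto simp: elastic_gradients_def)
  qed
  moreover have "chain_energy n w \<le> chain_energy n z"
    unfolding chain_energy_def
  proof (intro sum_mono ereal_mult_left_mono)
    fix i assume "i \<in> {..<n}"
    then have i: "i < n" by simp
    consider "z i \<le> 0" | "0 < z i" "z i \<le> 1" | "1 < z i" by linarith
    then show "V i (w i) \<le> V i (z i)"
    proof cases
      case 2
      then have "P.v i (w i) \<le> P.v i (z i)"
        using w[OF i] by (intro P.v_antimono) (auto simp: y_def)
      then show ?thesis using 2 w[OF i] by (simp add: P.V_eq y_def)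
    next
      case 3
      then have "w i = 1" by (simp add: w_def y_def)
      then show ?thesis by (simp add: P.min_at_1)
    qed (simp add: P.infinite_nonpos)
  qed simp
  ultimately show "\<exists>w \<in> elastic_gradients n \<inter> gradients n l. chain_energy n w \<le> chain_energy n z"
    by blast
qed

context
  fixes n :: nat assumes n: "0 < n"
begin

private abbreviation "m \<equiv> mean_compliance n"

lemma sum_compliance: "(\<Sum>i<n. 1 / P.K i) = n * m"
  using n by (simp add: mean_compliance_def)

lemma K_pos: "0 < P.K i"
  using P.K_bounds(1)[of i] c_pos by linarith

lemma mean_compliance_bounds: "c \<le> m" "m \<le> 1 / c"
proof -
  have "n * c = (\<Sum>i<n. c)" by simp
  also have "\<dots> \<le> (\<Sum>i<n. 1 / P.K i)"
    using P.K_bounds(2) K_pos c_pos by (intro sum_mono) (simp add: field_simps)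
  finally show "c \<le> m" using n by (simp add: sum_compliance)
  have "(\<Sum>i<n. 1 / P.K i) \<le> (\<Sum>i<n. 1 / c)"
    using P.K_bounds(1) K_pos c_pos by (intro sum_mono) (simp add: frac_le)
  also have "\<dots> = n * (1 / c)" by simp
  finally show "m \<le> 1 / c" unfolding sum_compliance using n by (simp only: mult_le_cancel_left_pos of_nat_0_less_iff)
qed

lemma m_pos: "0 < m"
  using mean_compliance_bounds c_pos by linarith

text \<open>Equal forces in all bonds: the stretch of each bond is proportional to its compliance.\<close>

lemma elastic_competitor:
  fixes d :: real
  assumes d: "0 < d" "d < c ^ 3"
  obtains w where "w \<in> elastic_gradients n \<inter> gradients n (1 + d)" "\<And>i. 0 < w i"
    "excess n w \<le> n * (1 + d / c ^ 4) * d\<^sup>2 / (2 * m)"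
proof
  define h where "h i = d / (m * P.K i)" for i
  define w where "w i = 1 + h i" for i
  have h: "0 < h i" "h i \<le> d / c\<^sup>2" for i
  proof -
    show "0 < h i" unfolding h_def using d m_pos K_pos by simp
    have "c * c \<le> m * P.K i"
      using mean_compliance_bounds P.K_bounds c_pos m_pos by (intro mult_mono) auto
    then show "h i \<le> d / c\<^sup>2"
      unfolding h_def power2_eq_square using d c_pos m_pos K_pos by (intro divide_left_mono) auto
  qed
  \<comment> \<open>The bound \<open>d < c ^ 3\<close> keeps all bonds inside the window of (A4), in
    particular elastic.\<close>
  have hc: "h i < c" for i
  proof (rule le_less_trans[OF h(2)])
    show "d / c\<^sup>2 < c" using d c_pos by (simp add: divide_less_eq eval_nat_numeral)
  qed
  show "0 < w i" for i using h[of i] by (simp add: w_def)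
  show "w \<in> elastic_gradients n \<inter> gradients n (1 + d)"
  proof
    have "ereal (w i) \<le> z_frac (V i)" for i
      by (rule order_trans[OF _ P.z_frac_ge]) (use hc[of i] in \<open>simp add: w_def\<close>)
    then show "w \<in> elastic_gradients n" by (simp add: elastic_gradients_def)
    have "(\<Sum>i<n. h i) = d / m * (\<Sum>i<n. 1 / P.K i)"
      by (simp add: h_def sum_distrib_left)
    then have "(\<Sum>i<n. h i) = n * d" unfolding sum_compliance using m_pos by simp
    then show "w \<in> gradients n (1 + d)"
      using h(1) by (auto simp: gradients_def w_def sum.distrib algebra_simps intro!: less_imp_le add_pos_pos)
  qed
  have "excess n w \<le> (\<Sum>i<n. (1 + d / c ^ 4) * d\<^sup>2 / (2 * m\<^sup>2) * (1 / P.K i))"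
    unfolding excess_def
  proof (rule sum_mono)
    fix i
    have "P.v i (w i) - P.v i 1 \<le> 1/2 * P.K i * (1 + h i / c\<^sup>2) * (h i)\<^sup>2"
      unfolding w_def using h[of i] hc[of i] by (intro P.quadratic_bounds) auto
    also have "\<dots> \<le> 1/2 * P.K i * (1 + d / c ^ 4) * (h i)\<^sup>2"
      using divide_right_mono[OF h(2), of "c\<^sup>2" i] K_pos[of i]
      by (intro mult_right_mono mult_left_mono) (auto simp: eval_nat_numeral mult_ac)
    also have "\<dots> = (1 + d / c ^ 4) * d\<^sup>2 / (2 * m\<^sup>2) * (1 / P.K i)"
      using K_pos[of i] m_pos by (simp add: h_def power2_eq_square field_simps)
    finally show "P.v i (w i) - P.v i 1 \<le> (1 + d / c ^ 4) * d\<^sup>2 / (2 * m\<^sup>2) * (1 / P.K i)" .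
  qed
  also have "\<dots> = n * (1 + d / c ^ 4) * d\<^sup>2 / (2 * m)"
    unfolding sum_distrib_left[symmetric] sum_compliance using m_pos
    by (simp add: power2_eq_square field_simps)
  finally show "excess n w \<le> n * (1 + d / c ^ 4) * d\<^sup>2 / (2 * m)" .
qed

text \<open>Duality: the tangent lines of slope \<open>s\<close> at all wells add up to a bound that depends on the mean
  stretch only. A broken bond of moderate length stays above its tangent line by half the barrier.\<close>

lemma excess_lower_bound:
  fixes d :: real
  assumes d: "0 < d" "2 * d < c ^ 4"
    and z: "z \<in> gradients n (1 + d)" "\<And>i. i < n \<Longrightarrow> 0 < z i"
    and R: "0 \<le> R" "d / c * R \<le> c ^ 5 / 32"
    and moderate: "\<And>i. i < n \<Longrightarrow> ereal (z i) \<le> z_frac (V i) \<or> z i \<le> R"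
  shows "n * (1 - 2 * d / c ^ 4) * d\<^sup>2 / (2 * m) +
      (if z \<in> elastic_gradients n then 0 else c ^ 5 / 32) \<le> excess n z"
proof -
  define q where "q = 1 - 2 * d / c ^ 4"
  \<comment> \<open>The slope that maximises
    \<open>s * (n * d) - s\<^sup>2 / (2 * q) * (n * m)\<close>, the sum of the tangent bounds; the
    maximum is \<open>n * q * d\<^sup>2 / (2 * m)\<close>.\<close>
  define s where "s = q * d / m"
  \<comment> \<open>A window large enough for \<open>s \<le> 1/2 * q * K * r\<close> at every bond,
    because \<open>m * K\<close> is at least \<open>c\<^sup>2\<close>. It determines
    \<open>q\<close> through \<open>q = 1 - r / c\<^sup>2\<close>.\<close>
  define r where "r = 2 * d / c\<^sup>2"
  \<comment> \<open>Surplus over the tangent line: the barrier \<open>c ^ 5 / 16\<close> of a broken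
    bond minus at most \<open>s * R\<close>.\<close>
  define D where "D i = (if ereal (z i) \<le> z_frac (V i) then 0 else c ^ 5 / 32)" for i
  have q: "0 < q" "q \<le> 1" using d c_pos by (auto simp: q_def)
  have q_r: "q = 1 - r / c\<^sup>2" by (simp add: q_def r_def eval_nat_numeral mult_ac)
  have c2: "c\<^sup>2 \<le> c" using c_pos c_less_1 by (simp add: power2_eq_square)
  have "r / c\<^sup>2 < 1" using q q_r by simp
  then have "r < c\<^sup>2" using c_pos by simp
  then have r: "0 < r" "r < c" using d c_pos c2 by (auto simp: r_def)
  have s0: "0 \<le> s" unfolding s_def using q d m_pos by simp
  have sK: "s \<le> 1/2 * q * P.K i * r" for i
  proof -
    have "c * c \<le> m * P.K i"
      using mean_compliance_bounds P.K_bounds c_pos m_pos by (intro mult_mono) auto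
    then have "1 / m \<le> P.K i / c\<^sup>2"
      using c_pos m_pos by (simp add: field_simps power2_eq_square)
    then have "q * d * (1 / m) \<le> q * d * (P.K i / c\<^sup>2)"
      using q d by (intro mult_left_mono) auto
    then show ?thesis by (simp add: s_def r_def field_simps)
  qed
  have "s \<le> d / c"
  proof -
    have "q * d / m \<le> 1 * d / c"
      using q d mean_compliance_bounds c_pos by (intro frac_le mult_right_mono) auto
    then show ?thesis by (simp add: s_def)
  qed
  then have sR: "s * R \<le> c ^ 5 / 32" using R by (meson mult_right_mono order_trans)
  have "s * (z i - 1) - s\<^sup>2 / (2 * q) * (1 / P.K i) + D i \<le> P.v i (z i) - P.v i 1" if i: "i < n" for i
  proof (cases "ereal (z i) \<le> z_frac (V i)")
    case True
    then show ?thesis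
      using P.elastic_lower_bound[OF r q_r q(1) s0 sK z(2)[OF i] True] by (simp add: D_def)
  next
    case False
    then have "s * z i \<le> s * R" using moderate[OF i] s0 by (intro mult_left_mono) auto
    moreover have "0 \<le> s\<^sup>2 / (2 * q) * (1 / P.K i)" using q K_pos[of i] by simp
    moreover have "c ^ 5 / 16 \<le> P.v i (z i) - P.v i 1"
      using False by (intro P.broken_lower_bound) simp
    ultimately show ?thesis using False sR s0 by (simp add: D_def algebra_simps)
  qed
  then have "(\<Sum>i<n. s * (z i - 1) - s\<^sup>2 / (2 * q) * (1 / P.K i) + D i) \<le> excess n z"
    unfolding excess_def by (intro sum_mono) simp
  moreover have "(\<Sum>i<n. s * (z i - 1) - s\<^sup>2 / (2 * q) * (1 / P.K i) + D i) =
      s * (n * d) - s\<^sup>2 / (2 * q) * (n * m) + (\<Sum>i<n. D i)"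
    using z(1) unfolding sum.distrib sum_subtractf sum_distrib_left[symmetric] sum_compliance
    by (simp add: gradients_def algebra_simps)
  moreover have "s * (n * d) - s\<^sup>2 / (2 * q) * (n * m) = n * q * d\<^sup>2 / (2 * m)"
    using m_pos q by (simp add: s_def power2_eq_square field_simps)
  moreover have "(if z \<in> elastic_gradients n then 0 else c ^ 5 / 32) \<le> (\<Sum>i<n. D i)"
  proof (cases "z \<in> elastic_gradients n")
    case False
    then obtain i where i: "i < n" "\<not> ereal (z i) \<le> z_frac (V i)"
      by (auto simp: elastic_gradients_def)
    have "D i \<le> (\<Sum>i<n. D i)"
      by (rule member_le_sum) (use i c_pos in \<open>auto simp: D_def\<close>)
    then show ?thesis using False i by (simp add: D_def)
  qed (use c_pos in \<open>auto simp: D_def intro: sum_nonneg\<close>)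
  ultimately show ?thesis by (simp add: q_def)
qed

text \<open>The equal-force competitor does at least as well as any non-elastic field. A bond longer
  than \<open>R\<close> alone outweighs it by \<open>long\<close>, all others contributing
  nonnegatively. Without such a bond, the upper and lower elastic bounds differ by
  \<open>3 * n * d ^ 3 / (2 * c ^ 4 * m)\<close>, which \<open>small\<close> keeps within the
  surplus \<open>c ^ 5 / 32\<close> of a broken bond.\<close>

lemma elastic_optimal_stretched:
  fixes d :: real
  assumes d: "0 < d" "2 * d < c ^ 4"
    and R: "0 \<le> R" "d / c * R \<le> c ^ 5 / 32"
    and small: "3 * n * d ^ 3 \<le> c ^ 10 / 16"
    and long: "\<And>i z. R \<le> z \<Longrightarrow> n * (1 + d / c ^ 4) * d\<^sup>2 / (2 * m) \<le> P.v i z - P.v i 1"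
  shows "elastic_optimal n (1 + d)"
proof (rule elastic_optimalI)
  fix z assume z: "z \<in> gradients n (1 + d)"
  have "c ^ 4 \<le> c ^ 3" using c_pos c_less_1 by (intro power_decreasing) auto
  then have "d < c ^ 3" using d by linarith
  then obtain w where w: "w \<in> elastic_gradients n \<inter> gradients n (1 + d)" "\<And>i. 0 < w i"
    "excess n w \<le> n * (1 + d / c ^ 4) * d\<^sup>2 / (2 * m)"
    using elastic_competitor[OF d(1)] by blast
  consider "z \<in> elastic_gradients n" | i where "i < n" "z i \<le> 0"
    | "z \<notin> elastic_gradients n" "\<And>i. i < n \<Longrightarrow> 0 < z i" by force
  then show "\<exists>w \<in> elastic_gradients n \<inter> gradients n (1 + d). chain_energy n w \<le> chain_energy n z"
  proof cases
    case 1
    then show ?thesis using z by blast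
  next
    case 2
    then show ?thesis using w chain_energy_nonpos[of i n z] by auto
  next
    case 3
    have "excess n w \<le> excess n z"
    proof (cases "\<exists>i<n. R < z i")
      case True
      then obtain i where i: "i < n" "R < z i" by blast
      have "P.v i (z i) - P.v i 1 \<le> excess n z"
        unfolding excess_def
        by (rule member_le_sum) (use i 3 P.v_min in \<open>auto simp: 3\<close>)
      then show ?thesis using long[of "z i" i] i w by linarith
    next
      case False
      then have moderate: "z i \<le> R" if "i < n" for i using that by force
      have "n * (1 - 2 * d / c ^ 4) * d\<^sup>2 / (2 * m) +
          (if z \<in> elastic_gradients n then 0 else c ^ 5 / 32) \<le> excess n z"
        by (rule excess_lower_bound[OF d z 3(2) R]) (auto simp: moderate)
      then have lower: "n * (1 - 2 * d / c ^ 4) * d\<^sup>2 / (2 * m) + c ^ 5 / 32 \<le> excess n z"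
        using 3 by simp
      have "n * (1 + d / c ^ 4) * d\<^sup>2 / (2 * m) - n * (1 - 2 * d / c ^ 4) * d\<^sup>2 / (2 * m)
          = 3 * n * d ^ 3 / (2 * c ^ 4 * m)"
        using m_pos c_pos by (simp add: field_simps eval_nat_numeral)
      also have "\<dots> \<le> (c ^ 10 / 16) / (2 * c ^ 4 * c)"
        using small c_pos m_pos d mean_compliance_bounds
        by (intro frac_le mult_left_mono) auto
      also have "\<dots> = c ^ 5 / 32" using c_pos by (simp add: field_simps eval_nat_numeral)
      finally show ?thesis using lower w by linarith
    qed
    then show ?thesis
      using w n by (intro bexI[of _ w]) (auto simp: chain_energy_pos 3 divide_right_mono)
  qed
qed

lemma not_elastic_optimal:
  fixes d :: real
  assumes d: "0 < d" "2 * d < c ^ 4" and j: "j < n"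
    and broken: "P.v j (1 + n * d) - P.v j 1 < n * (1 - 2 * d / c ^ 4) * d\<^sup>2 / (2 * m)"
  shows "\<not> elastic_optimal n (1 + d)"
proof -
  define B where "B = (\<Sum>i<n. P.v i 1)"
  \<comment> \<open>Bond \<open>j\<close> takes up all the excess length \<open>n * d\<close>, so
    the others return to their ground state.\<close>
  define y where "y = (\<lambda>i. if i = j then 1 + n * d else 1)"
  have y: "0 < y i" for i using d by (simp add: y_def add_pos_nonneg)
  have "(\<Sum>i<n. y i) = (\<Sum>i<n. 1 + (if i = j then n * d else 0))"
    by (rule sum.cong) (auto simp: y_def)
  also have "\<dots> = n * (1 + d)" using j by (simp add: sum.distrib algebra_simps)
  finally have "y \<in> gradients n (1 + d)"
    using y by (auto simp: gradients_def less_imp_le)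
  moreover have "excess n y = P.v j (1 + n * d) - P.v j 1"
  proof -
    have "excess n y = (\<Sum>i<n. if i = j then P.v j (1 + n * d) - P.v j 1 else 0)"
      unfolding excess_def by (rule sum.cong) (auto simp: y_def)
    then show ?thesis using j by simp
  qed
  ultimately have "(INF z \<in> gradients n (1 + d). chain_energy n z) \<le>
      ereal ((B + (P.v j (1 + n * d) - P.v j 1)) / n)"
    using y by (intro INF_lower2[of y]) (simp_all add: chain_energy_pos B_def)
  also have "\<dots> < ereal ((B + n * (1 - 2 * d / c ^ 4) * d\<^sup>2 / (2 * m)) / n)"
    using n broken by (simp add: divide_strict_right_mono)
  also have "\<dots> \<le> (INF z \<in> elastic_gradients n \<inter> gradients n (1 + d). chain_energy n z)"
  proof (rule INF_greatest)
    fix z assume z: "z \<in> elastic_gradients n \<inter> gradients n (1 + d)"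
    show "ereal ((B + n * (1 - 2 * d / c ^ 4) * d\<^sup>2 / (2 * m)) / n) \<le> chain_energy n z"
    proof (cases "\<exists>i<n. z i \<le> 0")
      case True
      then show ?thesis using chain_energy_nonpos by auto
    next
      case False
      then have pos: "0 < z i" if "i < n" for i using that by force
      \<comment> \<open>For an elastic \<open>z\<close> the first alternative of
        \<open>moderate\<close> always holds, so \<open>R = 0\<close> is admissible.\<close>
      have "n * (1 - 2 * d / c ^ 4) * d\<^sup>2 / (2 * m) +
          (if z \<in> elastic_gradients n then 0 else c ^ 5 / 32) \<le> excess n z"
        by (rule excess_lower_bound[OF d _ pos, where R = 0])
          (use z c_pos in \<open>auto simp: elastic_gradients_def\<close>)
      then show ?thesis using z pos n by (auto simp: chain_energy_pos B_def divide_right_mono)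
    qed
  qed
  finally show ?thesis by (simp add: elastic_optimal_def)
qed

end

end

section \<open>The limit of long chains\<close>

text \<open>The admissible \<open>L\<close> are bounded by \<open>b\<close>, and their supremum is
  admissible because any \<open>l\<close> below it lies below some member. So
  \<open>GREATEST\<close> is a true maximum and not a default value.\<close>

lemma Greatest_initial_segment:
  fixes P :: "real \<Rightarrow> bool"
  assumes a: "\<And>l. 0 \<le> l \<Longrightarrow> l < a \<Longrightarrow> P l" and b: "0 \<le> b" "\<not> P b"
  defines "G \<equiv> GREATEST L. \<forall>l. 0 \<le> l \<and> l < L \<longrightarrow> P l"
  shows "a \<le> G" "G \<le> b"
proof -
  define S where "S = {L. \<forall>l. 0 \<le> l \<and> l < L \<longrightarrow> P l}"
  have aS: "a \<in> S" using a by (simp add: S_def)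
  have Sb: "L \<le> b" if "L \<in> S" for L
    using that b by (auto simp: S_def intro: leI)
  then have bdd: "bdd_above S" by (intro bdd_aboveI)
  have "\<forall>l. 0 \<le> l \<and> l < Sup S \<longrightarrow> P l"
  proof (intro allI impI)
    fix l assume l: "0 \<le> l \<and> l < Sup S"
    then obtain L where "L \<in> S" "l < L" using less_cSup_iff[OF _ bdd] aS by blast
    then show "P l" using l by (auto simp: S_def)
  qed
  then have SupS: "Sup S \<in> S" by (simp add: S_def)
  then have "G = Sup S"
    unfolding G_def using cSup_upper[OF _ bdd]
    by (intro Greatest_equality) (auto simp: S_def)
  then show "a \<le> G" "G \<le> b" using aS Sb SupS cSup_upper[OF aS bdd] by auto
qed

text \<open>The deterministic content of almost every realisation: \<open>b\<close> stands for
  \<beta> and \<open>\<mu>\<close> for \<open>1 / (2 * \<alpha>)\<close>. A bond given by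
  \<open>weakest_approx\<close> belongs to all chains that are long enough.\<close>

locale ergodic_chain = potential_chain V c for V c +
  fixes b \<mu> :: real and \<psi> :: "real \<Rightarrow> real"
  assumes decay: "\<And>i z. 1 \<le> z \<Longrightarrow> \<bar>P.v i z\<bar> \<le> \<psi> z"
    and decay_0: "(\<psi> \<longlongrightarrow> 0) at_top"
    and weakest_le: "\<And>i. b \<le> - P.v i 1"
    and weakest_approx: "\<And>\<eta>. 0 < \<eta> \<Longrightarrow> \<exists>j. - P.v j 1 < b + \<eta>"
    and compliance_lim: "mean_compliance \<longlonglongrightarrow> \<mu>"
begin

lemma mu_pos: "0 < \<mu>"
proof -
  have "c \<le> \<mu>"
    by (rule LIMSEQ_le_const[OF compliance_lim]) (use mean_compliance_bounds in \<open>auto intro!: exI[of _ 1]\<close>)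
  then show ?thesis using c_pos by simp
qed

lemma decay_eventually: "0 < \<eta> \<Longrightarrow> \<exists>R\<ge>1. \<forall>z\<ge>R. \<psi> z < \<eta>"
proof -
  assume "0 < \<eta>"
  then have "\<forall>\<^sub>F z in at_top. \<psi> z < \<eta>" using order_tendstoD(2)[OF decay_0] by blast
  then obtain R where "\<forall>z\<ge>R. \<psi> z < \<eta>" by (auto simp: eventually_at_top_linorder)
  then show ?thesis by (intro exI[of _ "max 1 R"]) auto
qed

text \<open>Far out, a bond has nearly zero energy, yet it lies at least \<open>c ^ 5 / 16\<close>
  above its minimum; so every well is at least that deep.\<close>

lemma weakest_pos: "0 < b"
proof -
  have bound: "c ^ 5 / 16 \<le> b + 2 * \<eta>" if \<eta>: "0 < \<eta>" for \<eta>
  proof -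
    obtain j where j: "- P.v j 1 < b + \<eta>" using weakest_approx[OF \<eta>] by blast
    obtain R where R: "R \<ge> 1" "\<forall>z\<ge>R. \<psi> z < \<eta>" using decay_eventually[OF \<eta>] by blast
    define z where "z = max R (1 + c\<^sup>2 / 2)"
    have "c ^ 5 / 16 \<le> P.v j z - P.v j 1" by (rule P.barrier_lower_bound) (simp add: z_def)
    moreover have "\<bar>P.v j z\<bar> < \<eta>" using R by (intro le_less_trans[OF decay[of z j]]) (auto simp: z_def)
    ultimately show ?thesis using j by linarith
  qed
  have c5: "0 < c ^ 5" using c_pos by (rule zero_less_power)
  have "c ^ 5 / 16 \<le> b + 2 * (c ^ 5 / 64)" by (rule bound) (use c_pos in simp)
  then show ?thesis using c5 by linarith
qed

text \<open>Uniform in \<open>d\<close>, since the critical stretch requires optimality at all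
  smaller stretches. The smallness conditions of \<open>elastic_optimal_stretched\<close> are
  monotone in \<open>d\<close>, so \<open>d = g / sqrt n\<close> decides.\<close>

lemma eventually_elastic_optimal:
  assumes g: "0 < g" "g\<^sup>2 / (2 * \<mu>) < b"
  shows "\<forall>\<^sub>F n in sequentially. \<forall>d. 0 < d \<and> d \<le> g / sqrt n \<longrightarrow> elastic_optimal n (1 + d)"
proof -
  \<comment> \<open>The gap below \<open>b\<close> is \<open>2 * \<eta>\<close>: one
    \<open>\<eta>\<close> for the residual energy of a bond beyond \<open>R\<close>, one for the
    convergence in \<open>n\<close>.\<close>
  define \<eta> where "\<eta> = (b - g\<^sup>2 / (2 * \<mu>)) / 2"
  have \<eta>: "0 < \<eta>" "g\<^sup>2 / (2 * \<mu>) < b - \<eta>" using g by (auto simp: \<eta>_def field_simps)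
  obtain R where R: "R \<ge> 1" "\<forall>z\<ge>R. \<psi> z < \<eta>" using decay_eventually[OF \<eta>(1)] by blast
  have "((\<lambda>n. (1 + g / sqrt (real n) / c ^ 4) * g\<^sup>2 / (2 * mean_compliance n)) \<longlongrightarrow>
      (1 + 0 / c ^ 4) * g\<^sup>2 / (2 * \<mu>)) sequentially"
    by (intro tendsto_intros compliance_lim) (use mu_pos c_pos in \<open>auto, real_asymp\<close>)
  then have "\<forall>\<^sub>F n in sequentially. (1 + g / sqrt (real n) / c ^ 4) * g\<^sup>2 / (2 * mean_compliance n) < b - \<eta>"
    using \<eta> by (intro order_tendstoD(2)) auto
  moreover have "\<forall>\<^sub>F n in sequentially. 2 * (g / sqrt (real n)) < c ^ 4"
  proof (rule order_tendstoD(2))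
    show "(\<lambda>n. 2 * (g / sqrt (real n))) \<longlonglongrightarrow> 0" by real_asymp
  qed (use c_pos in simp)
  moreover have "\<forall>\<^sub>F n in sequentially. (g / sqrt (real n)) * (R / c) < c ^ 5 / 32"
  proof (rule order_tendstoD(2))
    show "(\<lambda>n. (g / sqrt (real n)) * (R / c)) \<longlonglongrightarrow> 0"
      by (rule tendsto_mult_left_zero) real_asymp
  qed (use c_pos in simp)
  moreover have "\<forall>\<^sub>F n in sequentially. 3 * real n * (g / sqrt (real n)) ^ 3 < c ^ 10 / 16"
  proof (rule order_tendstoD(2))
    show "(\<lambda>n. 3 * real n * (g / sqrt (real n)) ^ 3) \<longlonglongrightarrow> 0" using g(1) by real_asymp
  qed (use c_pos in simp)
  moreover have "\<forall>\<^sub>F n::nat in sequentially. 0 < n" by (rule eventually_gt_at_top)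
  ultimately show ?thesis
  proof eventually_elim
    case (elim n)
    have m: "0 < mean_compliance n" using m_pos elim by simp
    show ?case
    proof (intro allI impI)
      fix d assume "0 < d \<and> d \<le> g / sqrt n"
      then have d: "0 < d" "d \<le> g / sqrt n" by auto
      have nd: "n * d\<^sup>2 \<le> g\<^sup>2"
      proof -
        have "d * sqrt n \<le> g" using d elim by (simp add: pos_le_divide_eq)
        then have "(d * sqrt n)\<^sup>2 \<le> g\<^sup>2" using d by (intro power_mono) auto
        then show ?thesis by (simp add: power_mult_distrib mult.commute)
      qed
      show "elastic_optimal n (1 + d)"
      proof (rule elastic_optimal_stretched[where R = R])
        have "d * (R / c) \<le> (g / sqrt n) * (R / c)"
          using d R c_pos by (intro mult_right_mono) auto
        also have "\<dots> < c ^ 5 / 32" by (rule elim)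
        finally show "d / c * R \<le> c ^ 5 / 32" by (simp add: mult.commute)
        have "3 * n * d ^ 3 \<le> 3 * n * (g / sqrt n) ^ 3"
          using d by (intro mult_left_mono power_mono) auto
        then show "3 * n * d ^ 3 \<le> c ^ 10 / 16" using elim by linarith
      next
        fix i z assume z: "R \<le> z"
        have "n * (1 + d / c ^ 4) * d\<^sup>2 / (2 * mean_compliance n) =
            (1 + d / c ^ 4) * (n * d\<^sup>2) / (2 * mean_compliance n)" by (simp add: mult_ac)
        also have "\<dots> \<le> (1 + g / sqrt n / c ^ 4) * g\<^sup>2 / (2 * mean_compliance n)"
          using nd d c_pos m by (intro divide_right_mono mult_mono add_left_mono)
            (auto intro!: add_nonneg_nonneg divide_nonneg_nonneg less_imp_le[OF g(1)])
        also have "\<dots> \<le> b - \<eta>" using elim by simp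
        also have "\<dots> \<le> P.v i z - P.v i 1"
        proof -
          have "\<bar>P.v i z\<bar> < \<eta>" using decay[of z i] R z by (meson le_less_trans order_trans)
          then show ?thesis using weakest_le[of i] by linarith
        qed
        finally show "n * (1 + d / c ^ 4) * d\<^sup>2 / (2 * mean_compliance n) \<le> P.v i z - P.v i 1" .
      qed (use elim d R in auto)
    qed
  qed
qed

text \<open>A single bond \<open>j\<close> of nearly minimal breaking cost serves for all large
  \<open>n\<close>; its length \<open>1 + g * sqrt n\<close> tends to infinity, so its residual
  energy vanishes.\<close>

lemma eventually_not_elastic_optimal:
  assumes g: "0 < g" "b < g\<^sup>2 / (2 * \<mu>)"
  shows "\<forall>\<^sub>F n in sequentially. \<not> elastic_optimal n (1 + g / sqrt n)"
proof -
  \<comment> \<open>Three shares of the gap: the choice of \<open>j\<close>, the residual energy of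
    the broken bond, the convergence in \<open>n\<close>.\<close>
  define \<eta> where "\<eta> = (g\<^sup>2 / (2 * \<mu>) - b) / 3"
  have \<eta>: "0 < \<eta>" "b + 2 * \<eta> < g\<^sup>2 / (2 * \<mu>)" using g by (auto simp: \<eta>_def field_simps)
  obtain j where j: "- P.v j 1 < b + \<eta>" using weakest_approx[OF \<eta>(1)] by blast
  have "((\<lambda>n. (1 - 2 * (g / sqrt (real n)) / c ^ 4) * g\<^sup>2 / (2 * mean_compliance n)) \<longlongrightarrow>
      (1 - 2 * 0 / c ^ 4) * g\<^sup>2 / (2 * \<mu>)) sequentially"
    by (intro tendsto_intros compliance_lim) (use mu_pos c_pos in \<open>auto, real_asymp\<close>)
  then have "\<forall>\<^sub>F n in sequentially.
      b + 2 * \<eta> < (1 - 2 * (g / sqrt (real n)) / c ^ 4) * g\<^sup>2 / (2 * mean_compliance n)"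
    using \<eta> by (intro order_tendstoD(1)) auto
  moreover have "\<forall>\<^sub>F n in sequentially. 2 * (g / sqrt (real n)) < c ^ 4"
  proof (rule order_tendstoD(2))
    show "(\<lambda>n. 2 * (g / sqrt (real n))) \<longlonglongrightarrow> 0" by real_asymp
  qed (use c_pos in simp)
  moreover have "\<forall>\<^sub>F n in sequentially. \<psi> (1 + real n * (g / sqrt (real n))) < \<eta>"
  proof (rule order_tendstoD(2)[OF _ \<eta>(1)])
    have "filterlim (\<lambda>n. 1 + real n * (g / sqrt (real n))) at_top sequentially"
      using g(1) by real_asymp
    then show "(\<lambda>n. \<psi> (1 + real n * (g / sqrt (real n)))) \<longlonglongrightarrow> 0"
      by (rule filterlim_compose[OF decay_0])
  qed
  moreover have "\<forall>\<^sub>F n in sequentially. j < n" by (rule eventually_gt_at_top)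
  ultimately show ?thesis
  proof eventually_elim
    case (elim n)
    define d where "d = g / sqrt n"
    have d: "0 < d" using elim g by (simp add: d_def)
    have nd: "n * d\<^sup>2 = g\<^sup>2" using elim by (simp add: d_def power_divide)
    have "P.v j (1 + n * d) \<le> \<psi> (1 + n * d)"
      using decay[of "1 + n * d" j] d by simp
    then have "P.v j (1 + n * d) - P.v j 1 < b + 2 * \<eta>"
      using elim j by (simp add: d_def)
    also have "\<dots> < (1 - 2 * d / c ^ 4) * (n * d\<^sup>2) / (2 * mean_compliance n)"
      using elim unfolding nd by (simp add: d_def)
    also have "\<dots> = n * (1 - 2 * d / c ^ 4) * d\<^sup>2 / (2 * mean_compliance n)"
      by (simp add: mult_ac)
    finally show ?case
      using not_elastic_optimal[of n d j] d elim by (simp add: d_def)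
  qed
qed

text \<open>The elastic cost \<open>g\<^sup>2 / (2 * \<mu>)\<close> equals the breaking cost
  \<open>b\<close> exactly at \<open>g = sqrt (2 * b * \<mu>)\<close>; positive values of
  \<open>g\<close> on either side eventually enclose the threshold.\<close>

theorem jump_threshold_limit:
  "(\<lambda>n. ((GREATEST L. \<forall>l. 0 \<le> l \<and> l < L \<longrightarrow> elastic_optimal n l) - 1) / sqrt (1 / real n))
    \<longlonglongrightarrow> sqrt (2 * b * \<mu>)"
    (is "(\<lambda>n. (?G n - 1) / _) \<longlonglongrightarrow> ?\<gamma>")
proof -
  have \<gamma>: "0 < ?\<gamma>" using weakest_pos mu_pos by simp
  have bounds: "\<forall>\<^sub>F n in sequentially. g \<le> (?G n - 1) / sqrt (1 / real n) \<and> (?G n - 1) / sqrt (1 / real n) \<le> g'"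
    if g: "0 < g" "g < ?\<gamma>" "?\<gamma> < g'" for g g'
  proof -
    have "g\<^sup>2 < ?\<gamma>\<^sup>2" "?\<gamma>\<^sup>2 < g'\<^sup>2"
      using power_strict_mono[OF g(2), of 2] power_strict_mono[OF g(3), of 2] g \<gamma> by simp_all
    then have gb: "g\<^sup>2 / (2 * \<mu>) < b" "b < g'\<^sup>2 / (2 * \<mu>)"
      using weakest_pos mu_pos by (simp_all add: field_simps)
    have g': "0 < g'" using g by linarith
    show ?thesis
      using eventually_elastic_optimal[OF g(1) gb(1)] eventually_not_elastic_optimal[OF g' gb(2)]
        eventually_gt_at_top[of 0]
    proof eventually_elim
      case (elim n)
      have opt: "elastic_optimal n l" if "0 \<le> l" "l < 1 + g / sqrt n" for l
      proof (cases "l \<le> 1")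
        case True
        then show ?thesis using elastic_optimal_compressed elim by blast
      next
        case False
        then show ?thesis using elim(1)[rule_format, of "l - 1"] that by simp
      qed
      have "1 + g / sqrt n \<le> ?G n" "?G n \<le> 1 + g' / sqrt n"
        using Greatest_initial_segment[of "1 + g / sqrt n" "elastic_optimal n" "1 + g' / sqrt n"]
          opt elim g' by auto
      then show ?case using elim by (simp add: real_sqrt_divide field_simps)
    qed
  qed
  show ?thesis
  proof (rule order_tendstoI)
    fix a assume a: "a < ?\<gamma>"
    then obtain g where g: "max a 0 < g" "g < ?\<gamma>" using \<gamma> dense[of "max a 0" ?\<gamma>] by auto
    then have "\<forall>\<^sub>F n in sequentially. g \<le> (?G n - 1) / sqrt (1 / real n) \<and> (?G n - 1) / sqrt (1 / real n) \<le> ?\<gamma> + 1"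
      by (intro bounds) auto
    then show "\<forall>\<^sub>F n in sequentially. a < (?G n - 1) / sqrt (1 / real n)"
      by eventually_elim (use g in linarith)
  next
    fix a assume a: "?\<gamma> < a"
    then obtain g' where g': "?\<gamma> < g'" "g' < a" using dense by blast
    have "\<forall>\<^sub>F n in sequentially. ?\<gamma> / 2 \<le> (?G n - 1) / sqrt (1 / real n) \<and> (?G n - 1) / sqrt (1 / real n) \<le> g'"
      using g' \<gamma> by (intro bounds) auto
    then show "\<forall>\<^sub>F n in sequentially. (?G n - 1) / sqrt (1 / real n) < a"
      by eventually_elim (use g' in linarith)
  qed
qed

end

section \<open>Deformations and their discrete gradients\<close>

lemma deformation_gradients:
  assumes u: "u \<in> deformations_bc n l" and n: "0 < n"
  shows "i < n \<Longrightarrow> 0 \<le> disc_grad n u i" "(\<Sum>i<n. disc_grad n u i) = n * l"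
proof -
  have mono: "mono_on {0..1} u" and bc: "u 0 = 0" "u 1 = l"
    using u by (auto simp: deformations_bc_def deformations_def)
  show "0 \<le> disc_grad n u i" if "i < n"
  proof -
    have "u (i / n) \<le> u ((real i + 1) / n)"
      by (rule mono_onD[OF mono]) (use that n in \<open>auto simp: field_simps\<close>)
    then show ?thesis by (simp add: disc_grad_def)
  qed
  have "(\<Sum>i<n. disc_grad n u i) = n * (\<Sum>i<n. u (real (Suc i) / n) - u (real i / n))"
    by (simp add: disc_grad_def sum_distrib_left add.commute)
  also have "\<dots> = n * l"
    unfolding sum_lessThan_telescope[of "\<lambda>i. u (real i / n)"] using n bc by simp
  finally show "(\<Sum>i<n. disc_grad n u i) = n * l" .
qed

lemma deformation_of_gradients:
  fixes z :: "nat \<Rightarrow> real" and l :: real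
  assumes n: "0 < n" and z: "\<And>i. i < n \<Longrightarrow> 0 \<le> z i" "(\<Sum>i<n. z i) = n * l"
  obtains u where "u \<in> deformations_bc n l" "\<And>i. i < n \<Longrightarrow> disc_grad n u i = z i"
proof
  \<comment> \<open>A sum of ramps clamped to \<open>[0, 1]\<close>, one per cell: continuity and
    monotonicity hold termwise, and inside a cell only its own ramp varies.\<close>
  define u where "u x = (\<Sum>i<n. z i * max 0 (min 1 (n * x - i))) / n" for x :: real
  have trunc: "(\<Sum>i<n. if i < k then z i else 0) = (\<Sum>i<k. z i)" if "k \<le> n" for k
    using that by (auto simp: sum.If_cases intro!: sum.cong)
  have node: "u (k / n) = (\<Sum>i<k. z i) / n" if "k \<le> n" for k
  proof -
    have "(\<Sum>i<n. z i * max 0 (min 1 (n * (k / n) - i))) = (\<Sum>i<n. if i < k then z i else 0)"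
      using n by (intro sum.cong) auto
    then show ?thesis using trunc[OF that] by (simp add: u_def)
  qed
  show "disc_grad n u i = z i" if "i < n" for i
    using node[of i] node[of "Suc i"] that n by (simp add: disc_grad_def field_simps)
  have "u x = z k * x + ((\<Sum>i<k. z i) - k * z k) / n"
    if k: "k < n" and x: "x \<in> {real k / n<..<(real k + 1) / n}" for k x
  proof -
    have x': "k < n * x" "n * x < k + 1" using x n by (auto simp: field_simps)
    have "(\<Sum>i<n. z i * max 0 (min 1 (n * x - i))) =
        (\<Sum>i<n. (if i < k then z i else 0) + (if i = k then z k * (n * x - k) else 0))"
    proof (rule sum.cong)
      fix i
      consider "i < k" | "i = k" | "k < i" by linarith
      then show "z i * max 0 (min 1 (n * x - i)) =
          (if i < k then z i else 0) + (if i = k then z k * (n * x - k) else 0)"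
      proof cases
        case 1
        then have "real i + 1 \<le> k" by linarith
        then have "max 0 (min 1 (n * x - i)) = 1" using x' by simp
        then show ?thesis using 1 by simp
      next
        case 3
        then have "real k + 1 \<le> i" by linarith
        then have "max 0 (min 1 (n * x - i)) = 0" using x' by simp
        then show ?thesis using 3 by simp
      qed (use x' in simp)
    qed simp
    also have "\<dots> = (\<Sum>i<k. z i) + z k * (n * x - k)"
      unfolding sum.distrib using k trunc[of k] by simp
    finally show ?thesis using n by (simp add: u_def field_simps)
  qed
  then have "\<forall>k<n. \<exists>a b. \<forall>x\<in>{real k / n<..<(real k + 1) / n}. u x = a * x + b" by blast
  moreover have "mono_on {0..1} u"
  proof (rule mono_onI)
    fix x y :: real assume "x \<le> y"
    then have "n * x \<le> n * y" by (simp add: mult_left_mono)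
    then show "u x \<le> u y"
      unfolding u_def using z
      by (intro divide_right_mono sum_mono mult_left_mono max.mono min.mono) auto
  qed
  moreover have "continuous_on {0..1} u"
    unfolding u_def[abs_def] by (intro continuous_intros) (use n in auto)
  moreover have "u 0 = 0" "u 1 = l" using node[of 0] node[of n] z n by auto
  ultimately show "u \<in> deformations_bc n l"
    by (simp add: deformations_bc_def deformations_def)
qed

lemma critical_stretch_eq:
  assumes n: "0 < n" and chain: "potential_chain (\<lambda>i. J (\<tau> (int i) \<omega>)) c"
  shows "critical_stretch \<tau> J n \<omega> =
    (GREATEST L. \<forall>l. 0 \<le> l \<and> l < L \<longrightarrow> potential_chain.elastic_optimal (\<lambda>i. J (\<tau> (int i) \<omega>)) n l)"
proof -
  interpret potential_chain "\<lambda>i. J (\<tau> (int i) \<omega>)" c by (rule chain)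
  have energy: "energy \<tau> J n \<omega> u = chain_energy n z"
    if "\<And>i. i < n \<Longrightarrow> disc_grad n u i = z i" for u z
    using that by (simp add: energy_def chain_energy_def)
  have grad: "disc_grad n u \<in> gradients n l" if "u \<in> deformations_bc n l" for u l
    using deformation_gradients[OF that n] by (simp add: gradients_def)
  have deform: "\<exists>u\<in>deformations_bc n l. \<forall>i<n. disc_grad n u i = z i" if "z \<in> gradients n l" for z l
  proof -
    have "\<And>i. i < n \<Longrightarrow> 0 \<le> z i" "(\<Sum>i<n. z i) = n * l" using that by (auto simp: gradients_def)
    then show ?thesis by (rule deformation_of_gradients[OF n]) auto
  qed
  have elastic: "u \<in> elastic \<tau> J n \<omega> \<longleftrightarrow> z \<in> elastic_gradients n"
    if "u \<in> deformations_bc n l" "\<And>i. i < n \<Longrightarrow> disc_grad n u i = z i" for u z l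
    using that by (auto simp: elastic_def elastic_gradients_def deformations_bc_def)
  have "(INF u \<in> deformations_bc n l. energy \<tau> J n \<omega> u) = (INF z \<in> gradients n l. chain_energy n z)" for l
    by (rule INF_eq) (use grad deform energy in \<open>metis order_refl\<close>)+
  moreover have "(INF u \<in> elastic \<tau> J n \<omega> \<inter> deformations_bc n l. energy \<tau> J n \<omega> u) =
      (INF z \<in> elastic_gradients n \<inter> gradients n l. chain_energy n z)" for l
  proof (rule INF_eq)
    fix u assume u: "u \<in> elastic \<tau> J n \<omega> \<inter> deformations_bc n l"
    then show "\<exists>z\<in>elastic_gradients n \<inter> gradients n l. chain_energy n z \<le> energy \<tau> J n \<omega> u"
      using grad elastic[of u l] energy by (intro bexI[of _ "disc_grad n u"]) auto
  next
    fix z assume z: "z \<in> elastic_gradients n \<inter> gradients n l"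
    then obtain u where "u \<in> deformations_bc n l" "\<forall>i<n. disc_grad n u i = z i"
      using deform by blast
    then show "\<exists>u\<in>elastic \<tau> J n \<omega> \<inter> deformations_bc n l. energy \<tau> J n \<omega> u \<le> chain_energy n z"
      using z elastic[of u l z] energy[of u z] by (intro bexI[of _ u]) auto
  qed
  ultimately show ?thesis by (simp add: critical_stretch_def elastic_optimal_def)
qed

section \<open>Random potentials\<close>

text \<open>As \<open>V'\<close> vanishes at 1, a one-sided difference quotient suffices. It makes
  the curvature an almost sure limit of expressions measurable in \<omega>.\<close>

lemma (in fracture_potential) D2_as_limit:
  "(\<lambda>k. 2 * (real k)\<^sup>2 * (v (1 + 1 / real k) - v 1)) \<longlonglongrightarrow> K"
proof (rule tendsto_sandwich)
  have "\<forall>\<^sub>F k in sequentially. 1 / real k < c"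
    by (rule order_tendstoD(2)[OF lim_1_over_n c_pos])
  then have *: "\<forall>\<^sub>F k in sequentially. 0 < k \<and> 1 / real k < c"
    by (intro eventually_conj eventually_gt_at_top)
  then show "\<forall>\<^sub>F k in sequentially. K * (1 - 1 / real k / c\<^sup>2) \<le> 2 * (real k)\<^sup>2 * (v (1 + 1 / real k) - v 1)"
  proof eventually_elim
    case (elim k)
    then have "2 * (real k)\<^sup>2 * (1/2 * K * (1 - 1 / real k / c\<^sup>2) * (1 / real k)\<^sup>2) \<le>
        2 * (real k)\<^sup>2 * (v (1 + 1 / real k) - v 1)"
      by (intro mult_left_mono quadratic_bounds) auto
    then show ?case using elim by (simp add: power_divide)
  qed
  show "\<forall>\<^sub>F k in sequentially. 2 * (real k)\<^sup>2 * (v (1 + 1 / real k) - v 1) \<le> K * (1 + 1 / real k / c\<^sup>2)"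
    using *
  proof eventually_elim
    case (elim k)
    then have "2 * (real k)\<^sup>2 * (v (1 + 1 / real k) - v 1) \<le>
        2 * (real k)\<^sup>2 * (1/2 * K * (1 + 1 / real k / c\<^sup>2) * (1 / real k)\<^sup>2)"
      by (intro mult_left_mono quadratic_bounds) auto
    then show ?case using elim by (simp add: power_divide)
  qed
  have "(\<lambda>k. K * (1 - 1 / real k / c\<^sup>2)) \<longlonglongrightarrow> K * (1 - 0 / c\<^sup>2)"
    "(\<lambda>k. K * (1 + 1 / real k / c\<^sup>2)) \<longlonglongrightarrow> K * (1 + 0 / c\<^sup>2)"
    by (intro tendsto_intros lim_1_over_n; use c_pos in simp)+
  then show "(\<lambda>k. K * (1 - 1 / real k / c\<^sup>2)) \<longlonglongrightarrow> K" "(\<lambda>k. K * (1 + 1 / real k / c\<^sup>2)) \<longlonglongrightarrow> K"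
    by simp_all
qed

text \<open>All subsets of the null set where \<open>f\<close> and \<open>g\<close> differ are
  measurable in the completion. This handles the integrand of \<open>alpha_low\<close>, whose values
  on a null set are arbitrary.\<close>

lemma measurable_completion_AE_cong:
  assumes f: "f \<in> measurable M N" and g: "g \<in> space M \<rightarrow> space N" and eq: "AE x in M. f x = g x"
  shows "g \<in> measurable (completion M) N"
proof (rule measurableI)
  fix A assume A: "A \<in> sets N"
  have [measurable]: "Measurable.pred (completion M) (\<lambda>x. f x \<in> A)"
    using measurable_completion[OF f] A by measurable
  have [measurable]: "Measurable.pred (completion M) (\<lambda>x. f x \<noteq> g x)"
    "Measurable.pred (completion M) (\<lambda>x. f x \<noteq> g x \<and> g x \<in> A)"
    by (rule sets_completion_AE; use eq in \<open>auto elim: eventually_mono\<close>)+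
  have "Measurable.pred (completion M) (\<lambda>x. (f x \<noteq> g x \<and> g x \<in> A) \<or> (f x \<in> A \<and> \<not> f x \<noteq> g x))"
    by measurable
  moreover have "((f x \<noteq> g x \<and> g x \<in> A) \<or> (f x \<in> A \<and> \<not> f x \<noteq> g x)) = (g x \<in> A)" for x by auto
  ultimately have "Measurable.pred (completion M) (\<lambda>x. g x \<in> A)" by simp
  then show "g -` A \<inter> space (completion M) \<in> sets (completion M)"
    unfolding pred_def by (simp add: vimage_def Int_def conj_commute)
qed (use g in auto)

lemma (in random_potential) AE_fracture_potential:
  assumes "AE \<omega> in M. ground_state (J \<omega>) = 1"
  obtains c where "0 < c" "AE \<omega> in M. fracture_potential (J \<omega>) c"
proof -
  obtain c where c: "c > 0" and A4: "AE \<omega> in M. c < ground_state (J \<omega>) \<and> ground_state (J \<omega>) < 1 / c \<and>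
      (\<forall>z\<in>{ground_state (J \<omega>) - c<..<ground_state (J \<omega>) + c}.
        c \<le> Dpot 2 (J \<omega>) z \<and> Dpot 2 (J \<omega>) z \<le> 1 / c \<and> \<bar>Dpot 3 (J \<omega>) z\<bar> \<le> 1 / c)"
    using A4 by blast
  have "AE \<omega> in M. fracture_potential (J \<omega>) c"
    using assms A1 A3 A4 unique_minimizer AE_space
  proof eventually_elim
    case (elim \<omega>)
    \<comment> \<open>\<open>ground_state\<close> is a choice operator; it names a minimizer because
      one exists almost surely.\<close>
    have min: "is_minimizer (J \<omega>) 1"
      using elim(1,5) unfolding ground_state_def arg_min_def by (metis someI_ex)
    show ?case
    proof
      show "J \<omega> 1 \<le> J \<omega> z" for z using min by (auto simp: is_arg_min_def not_less)
      show "z = 1" if "J \<omega> z \<le> J \<omega> 1" for z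
      proof -
        have "is_minimizer (J \<omega>) z" using min that unfolding is_arg_min_def by (meson less_le_trans)
        then show ?thesis using elim(5) min by blast
      qed
    qed (use elim c J_nonpos in \<open>auto simp: abs_less_iff\<close>)
  qed
  with c show thesis by (rule that)
qed

lemma (in prob_space) esssup_real:
  fixes f :: "'a \<Rightarrow> ereal"
  assumes [measurable]: "f \<in> borel_measurable M" and bd: "AE \<omega> in M. \<bar>f \<omega>\<bar> \<le> ereal C"
  obtains e where "esssup M f = ereal e"
proof -
  have "esssup M f \<le> ereal C"
  proof (rule esssup_I)
    show "AE \<omega> in M. f \<omega> \<le> ereal C"
      using bd
    proof eventually_elim
      case (elim \<omega>)
      then show ?case by (cases "f \<omega>") auto
    qed
  qed simp
  moreover have "\<not> esssup M f < ereal (- C)"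
  proof
    assume less: "esssup M f < ereal (- C)"
    have "AE \<omega> in M. False"
      using bd esssup_AE[where f = f]
    proof eventually_elim
      case (elim \<omega>)
      then have "f \<omega> < ereal (- C)" using less by (metis le_less_trans)
      then show False using elim(1) by (cases "f \<omega>") auto
    qed
    then show False by simp
  qed
  ultimately show thesis using that by (cases "esssup M f") auto
qed

theorem theorem2p2:
  fixes M :: "'a measure" and \<tau> :: "int \<Rightarrow> 'a \<Rightarrow> 'a" and J :: "'a \<Rightarrow> real \<Rightarrow> ereal"
  assumes "ergodic_shift M \<tau>"
    and "random_potential M J"
    and "AE \<omega> in M. ground_state (J \<omega>) = 1"
  shows "AE \<omega> in M.
    (\<lambda>n. jump_threshold \<tau> J n \<omega>) \<longlonglongrightarrow> sqrt (beta M J / alpha_low M J)"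
proof -
  interpret ergodic_shift M \<tau> by (rule assms)
  interpret random_potential M J by (rule assms)
  obtain c where c: "0 < c" and pot: "AE \<omega> in M. fracture_potential (J \<omega>) c"
    using AE_fracture_potential[OF assms(3)] .
  obtain \<psi> :: "real \<Rightarrow> real" where \<psi>: "(\<psi> \<longlongrightarrow> 0) at_top"
    and \<psi>_bound: "AE \<omega> in M. \<forall>z\<ge>1. \<bar>J \<omega> z\<bar> \<le> ereal (\<psi> z)"
    using A2 by (auto elim!: eventually_mono)
  have J_meas: "(\<lambda>\<omega>. J \<omega> z) \<in> borel_measurable M" for z
  proof -
    have "(\<lambda>\<omega>. (\<omega>, z)) \<in> measurable M (M \<Otimes>\<^sub>M borel)" by simp
    from measurable_compose[OF this measurable_J] show ?thesis by simp
  qed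
  note J_meas [measurable]

  obtain e where e: "esssup M (\<lambda>\<omega>. J \<omega> 1) = ereal e"
    by (rule esssup_real[of "\<lambda>\<omega>. J \<omega> 1" "\<psi> 1"]) (use \<psi>_bound in \<open>auto elim: eventually_mono\<close>)
  have beta: "beta M J = - e"
    by (simp add: beta_def essinf_def e)
  have J_le: "AE \<omega> in M. J \<omega> 1 \<le> ereal e"
    using esssup_AE[where f = "\<lambda>\<omega>. J \<omega> 1" and M = M] by (simp add: e)
  \<comment> \<open>Values near the essential supremum have positive probability, so recurrence
    finds such a bond on the chain; countably many margins keep the exceptional set null.\<close>
  have J_ge: "AE \<omega> in M. \<forall>k::nat. \<exists>j. ereal (e - 1 / Suc k) < J (\<tau> (int j) \<omega>) 1"
    unfolding AE_all_countable
  proof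
    fix k :: nat
    let ?B = "{\<omega> \<in> space M. ereal (e - 1 / Suc k) < J \<omega> 1}"
    have "0 < emeasure M ?B" by (rule esssup_pos_measure) (auto simp: e)
    then have "0 < prob ?B" by (simp add: emeasure_eq_measure)
    then have "AE \<omega> in M. \<exists>j. \<tau> (int j) \<omega> \<in> ?B" by (intro recurrence) auto
    then show "AE \<omega> in M. \<exists>j. ereal (e - 1 / Suc k) < J (\<tau> (int j) \<omega>) 1"
      by eventually_elim auto
  qed

  \<comment> \<open>A version of \<open>J''(\<omega>, 1)\<close> that is measurable for
    \<open>M\<close> itself.\<close>
  define Y where "Y \<omega> = lim (\<lambda>k. 2 * (real k)\<^sup>2 *
      (real_of_ereal (J \<omega> (1 + 1 / real k)) - real_of_ereal (J \<omega> 1)))" for \<omega>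
  \<comment> \<open>Clamped so that the bound holds at every \<omega>, as
    \<open>birkhoff_bounded\<close> requires; almost surely this changes nothing.\<close>
  define f where "f \<omega> = min (1 / c) (max 0 (1 / Y \<omega>))" for \<omega>
  have f_meas [measurable]: "f \<in> borel_measurable M"
    unfolding f_def[abs_def] Y_def[abs_def] by measurable
  have f_bound: "\<bar>f \<omega>\<bar> \<le> 1 / c" for \<omega> using c by (simp add: f_def)
  have f_eq: "f \<omega> = 1 / Dpot 2 (J \<omega>) 1" if "fracture_potential (J \<omega>) c" for \<omega>
  proof -
    interpret fracture_potential "J \<omega>" c by fact
    have "Y \<omega> = K" unfolding Y_def v_def[symmetric] by (rule limI[OF D2_as_limit])
    moreover have "0 \<le> 1 / K" "1 / K \<le> 1 / c" using K_bounds c_pos by (auto intro: frac_le)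
    ultimately show ?thesis by (simp add: f_def K_def)
  qed
  have "(\<integral>\<omega>. inverse (1 / 2 * Dpot 2 (J \<omega>) 1) \<partial>completion M) = (\<integral>\<omega>. 2 * f \<omega> \<partial>completion M)"
  proof (rule integral_cong_AE)
    have ae: "AE \<omega> in M. 2 * f \<omega> = inverse (1 / 2 * Dpot 2 (J \<omega>) 1)"
      using pot by eventually_elim (simp add: f_eq field_simps)
    then show "(\<lambda>\<omega>. inverse (1 / 2 * Dpot 2 (J \<omega>) 1)) \<in> borel_measurable (completion M)"
      by (rule measurable_completion_AE_cong[rotated 2]) auto
    show "AE \<omega> in completion M. inverse (1 / 2 * Dpot 2 (J \<omega>) 1) = 2 * f \<omega>"
      by (rule AE_completion) (use ae in eventually_elim, simp)
  qed (intro measurable_completion; measurable)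
  also have "\<dots> = 2 * expectation f" by (simp add: integral_completion)
  finally have "alpha_low M J = inverse (2 * expectation f)"
    unfolding alpha_low_def by (rule arg_cong)
  \<comment> \<open>With \<open>b = - e\<close> and \<open>\<mu> = expectation f\<close> this is the
    radicand in \<open>jump_threshold_limit\<close>.\<close>
  then have alpha: "beta M J / alpha_low M J = 2 * (- e) * expectation f"
    by (simp only: beta divide_inverse inverse_inverse_eq mult_ac)

  have birkhoff: "AE \<omega> in M. (\<lambda>n. birkhoff_sum f n \<omega> / n) \<longlonglongrightarrow> expectation f"
    by (rule birkhoff_bounded[OF f_meas f_bound])
  have "AE \<omega> in M. \<forall>i. fracture_potential (J (\<tau> i \<omega>)) c \<and>
      (\<forall>z\<ge>1. \<bar>J (\<tau> i \<omega>) z\<bar> \<le> ereal (\<psi> z)) \<and> J (\<tau> i \<omega>) 1 \<le> ereal e"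
    by (rule AE_shift) (use pot \<psi>_bound J_le in eventually_elim, blast)
  with birkhoff J_ge show ?thesis
  proof eventually_elim
    case (elim \<omega>)
    define V where "V i = J (\<tau> (int i) \<omega>)" for i :: nat
    interpret C: potential_chain V c
      using elim(3) by (simp add: potential_chain_def V_def)
    have V1: "V i 1 = ereal (C.P.v i 1)" for i by (rule C.P.V_eq) simp
    interpret ergodic_chain V c "- e" "expectation f" \<psi>
    proof
      show "\<bar>C.P.v i z\<bar> \<le> \<psi> z" if "1 \<le> z" for i z
      proof -
        have "\<bar>V i z\<bar> \<le> ereal (\<psi> z)" using elim(3) that by (simp add: V_def)
        then show ?thesis using C.P.V_eq[of z i] that by simp
      qed
      show "- e \<le> - C.P.v i 1" for i
      proof -
        have "V i 1 \<le> ereal e" using elim(3) by (simp add: V_def)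
        then show ?thesis by (simp add: V1)
      qed
      show "\<exists>j. - C.P.v j 1 < - e + \<eta>" if \<eta>: "0 < \<eta>" for \<eta>
      proof -
        obtain k where k: "1 / real (Suc k) < \<eta>" using nat_approx_posE[OF \<eta>] by auto
        obtain j where "ereal (e - 1 / Suc k) < V j 1" using elim(2) by (auto simp: V_def)
        then have "e - 1 / Suc k < C.P.v j 1" by (simp add: V1)
        then show ?thesis using k by (intro exI[of _ j]) linarith
      qed
      have "f (\<tau> (int i) \<omega>) = 1 / C.P.K i" for i
        using elim(3) f_eq[of "\<tau> (int i) \<omega>"] C.P.K_def[of i] by (simp add: V_def)
      then have "C.mean_compliance n = birkhoff_sum f n \<omega> / n" for n
        by (simp add: C.mean_compliance_def birkhoff_sum_def)
      then show "C.mean_compliance \<longlonglongrightarrow> expectation f" using elim(1) by presburger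
    qed (rule \<psi>)
    have "\<forall>\<^sub>F n in sequentially. ((GREATEST L. \<forall>l. 0 \<le> l \<and> l < L \<longrightarrow> C.elastic_optimal n l) - 1) / sqrt (1 / real n)
        = jump_threshold \<tau> J n \<omega>"
      using eventually_gt_at_top[of 0]
    proof eventually_elim
      case (elim n)
      have V: "(\<lambda>i. J (\<tau> (int i) \<omega>)) = V" by (simp add: V_def fun_eq_iff)
      show ?case
        using critical_stretch_eq[OF elim, of J \<tau> \<omega> c] C.potential_chain_axioms
        by (simp add: jump_threshold_def V)
    qed
    then show ?case
      unfolding alpha using jump_threshold_limit by (rule Lim_transform_eventually[rotated])
  qed
qed

end
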